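(* Let $\Omega\subset\mathbb{R}^2$ be a bounded region whose boundary $\partial\Omega$ is the union of a finite number of disjoint simple Lipschitz loops. Then the following orthogonal direct sum decompositions hold: (a) $L^2(\Omega;\mathbb{R}^2)=\mathrm{Curl}_0(\Omega)\oplus N(\operatorname{curl})=G_0(\Omega)\oplus N(\operatorname{div})$, and (b) $L^2(\Omega;\mathbb{R}^2)=\mathrm{Curl}_0(\Omega)\oplus G_0(\Omega)\oplus\mathcal{H}^0(\Omega,\mathbb{R}^2)$.
   Context: A region is a non-empty connected open subset of $\mathbb{R}^2$. A simple Lipschitz loop is a closed, non-self-intersecting curve with at least two distinct points and a uniformly Lipschitz parametrization. $L^2(\Omega;\mathbb{R}^2)$ is the real Hilbert space of $L^2$ planar vector fields with inner product $\langle\mathbf{v},\mathbf{w}\rangle=\int_\Omega\mathbf{v}\cdot\mathbf{w}\,d^2x$; $\oplus$ denotes orthogonal direct sum for this inner product. $\nabla\varphi=(D_1\varphi,D_2\varphi)$, $\nabla^\perp\psi=(D_2\psi,-D_1\psi)$. $G_0(\Omega)=\{\nabla\varphi:\varphi\in H^1_0(\Omega)\}$, $\mathrm{Curl}_0(\Omega)=\{\nabla^\perp\psi:\psi\in H^1_0(\Omega)\}$. A field $\mathbf{v}$ is irrotational if $\int_\Omega\nabla^\perp\varphi\cdot\mathbf{v}\,d^2x=0$ for all $\varphi\in C^1_c(\Omega)$ and solenoidal if $\int_\Omega\nabla\varphi\cdot\mathbf{v}\,d^2x=0$ for all $\varphi\in C^1_c(\Omega)$. $N(\operatorname{curl})$,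 $N(\operatorname{div})$ are the subspaces of irrotational, respectively solenoidal, fields in $L^2(\Omega;\mathbb{R}^2)$, and $\mathcal{H}^0(\Omega,\mathbb{R}^2)$ is the subspace of harmonic fields, i.e. those that are both irrotational and solenoidal. *)

theory Defs
  imports "HOL-Analysis.Analysis"
begin

definition region :: "(real^2) set \<Rightarrow> bool" where
  "region \<Omega> \<longleftrightarrow> \<Omega> \<noteq> {} \<and> open \<Omega> \<and> connected \<Omega>"

(* simple_path allows the two endpoints to coincide and excludes constant paths, so a loop
   with simple_path automatically has two distinct points. *)
definition simple_Lipschitz_loop :: "(real \<Rightarrow> real^2) \<Rightarrow> bool" where
  "simple_Lipschitz_loop \<gamma> \<longleftrightarrow>
     simple_path \<gamma> \<and> pathfinish \<gamma> = pathstart \<gamma> \<and> (\<exists>C. C-lipschitz_on {0..1} \<gamma>)"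

definition boundary_finite_union_Lipschitz_loops :: "(real^2) set \<Rightarrow> bool" where
  "boundary_finite_union_Lipschitz_loops \<Omega> \<longleftrightarrow>
     (\<exists>\<Gamma>. finite \<Gamma> \<and> (\<forall>\<gamma>\<in>\<Gamma>. simple_Lipschitz_loop \<gamma>) \<and>
          pairwise (\<lambda>\<gamma> \<delta>. disjnt (path_image \<gamma>) (path_image \<delta>)) \<Gamma> \<and>
          frontier \<Omega> = (\<Union>\<gamma>\<in>\<Gamma>. path_image \<gamma>))"

(* Elements of L2 are represented by functions on the whole plane of which only the values in
   \<Omega> matter; equality in L2 is equality almost everywhere in \<Omega>.  The sets of fields
   below (G0, Curl0, N_curl, N_div) are all saturated under this equality. *)
definition L2 :: "(real^2) set \<Rightarrow> (real^2 \<Rightarrow> 'b::euclidean_space) set" where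
  "L2 \<Omega> = {f. f \<in> borel_measurable (lebesgue_on \<Omega>) \<and>
              integrable (lebesgue_on \<Omega>) (\<lambda>x. (norm (f x))\<^sup>2)}"

definition L2_eq :: "(real^2) set \<Rightarrow> (real^2 \<Rightarrow> 'b::euclidean_space) \<Rightarrow> (real^2 \<Rightarrow> 'b) \<Rightarrow> bool" where
  "L2_eq \<Omega> f g \<longleftrightarrow> (AE x in lebesgue_on \<Omega>. f x = g x)"

definition L2_inner :: "(real^2) set \<Rightarrow> (real^2 \<Rightarrow> real^2) \<Rightarrow> (real^2 \<Rightarrow> real^2) \<Rightarrow> real" where
  "L2_inner \<Omega> v w = (\<integral>x. v x \<bullet> w x \<partial>lebesgue_on \<Omega>)"

definition L2_subspace :: "(real^2) set \<Rightarrow> (real^2 \<Rightarrow> real^2) set \<Rightarrow> bool" where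
  "L2_subspace \<Omega> U \<longleftrightarrow>
     U \<subseteq> L2 \<Omega> \<and> (\<lambda>x. 0) \<in> U \<and>
     (\<forall>u\<in>U. \<forall>v\<in>U. (\<lambda>x. u x + v x) \<in> U) \<and>
     (\<forall>c. \<forall>u\<in>U. (\<lambda>x. c *\<^sub>R u x) \<in> U) \<and>
     (\<forall>u\<in>U. \<forall>v\<in>L2 \<Omega>. L2_eq \<Omega> u v \<longrightarrow> v \<in> U)"

(* L2 is the orthogonal direct sum of the subspaces in the list Us: they are mutually
   orthogonal, and each field is a sum of components from them, uniquely in L2. *)
definition L2_orthogonal_direct_sum ::
    "(real^2) set \<Rightarrow> (real^2 \<Rightarrow> real^2) set list \<Rightarrow> bool" where
  "L2_orthogonal_direct_sum \<Omega> Us \<longleftrightarrow>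
     (\<forall>U\<in>set Us. L2_subspace \<Omega> U) \<and>
     (\<forall>i<length Us. \<forall>j<length Us. i \<noteq> j \<longrightarrow>
        (\<forall>u\<in>Us ! i. \<forall>v\<in>Us ! j. L2_inner \<Omega> u v = 0)) \<and>
     (\<forall>w\<in>L2 \<Omega>. \<exists>u.
        (\<forall>i<length Us. u i \<in> Us ! i) \<and> L2_eq \<Omega> w (\<lambda>x. \<Sum>i<length Us. u i x) \<and>
        (\<forall>u'. (\<forall>i<length Us. u' i \<in> Us ! i) \<and> L2_eq \<Omega> w (\<lambda>x. \<Sum>i<length Us. u' i x) \<longrightarrow>
              (\<forall>i<length Us. L2_eq \<Omega> (u' i) (u i))))"

definition grad :: "(real^2 \<Rightarrow> real) \<Rightarrow> real^2 \<Rightarrow> real^2" where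
  "grad \<phi> x = (\<chi> j. frechet_derivative \<phi> (at x) (axis j 1))"

definition perp :: "real^2 \<Rightarrow> real^2" where
  "perp a = vector [a $ 2, - (a $ 1)]"

definition perp_grad :: "(real^2 \<Rightarrow> real) \<Rightarrow> real^2 \<Rightarrow> real^2" where
  "perp_grad \<phi> x = perp (grad \<phi> x)"

(* Functions with compact support in \<Omega>, extended by zero to the plane. *)
definition C1c :: "(real^2) set \<Rightarrow> (real^2 \<Rightarrow> real) set" where
  "C1c \<Omega> = {\<phi>. (\<forall>x. \<phi> differentiable (at x)) \<and> continuous_on UNIV (grad \<phi>) \<and>
               compact (closure {x. \<phi> x \<noteq> 0}) \<and> closure {x. \<phi> x \<noteq> 0} \<subseteq> \<Omega>}"

definition has_weak_grad :: "(real^2) set \<Rightarrow> (real^2 \<Rightarrow> real) \<Rightarrow> (real^2 \<Rightarrow> real^2) \<Rightarrow> bool" where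
  "has_weak_grad \<Omega> \<phi> g \<longleftrightarrow>
     (\<forall>\<eta>\<in>C1c \<Omega>. \<forall>j. (\<integral>x. \<phi> x * grad \<eta> x $ j \<partial>lebesgue_on \<Omega>) =
                     - (\<integral>x. g x $ j * \<eta> x \<partial>lebesgue_on \<Omega>))"

definition H1 :: "(real^2) set \<Rightarrow> (real^2 \<Rightarrow> real) set" where
  "H1 \<Omega> = {\<phi> \<in> L2 \<Omega>. \<exists>g\<in>L2 \<Omega>. has_weak_grad \<Omega> \<phi> g}"

(* The closure of C1c in H1; the square root is the H1 norm of \<phi> - \<eta>, since g - grad \<eta> is
   its weak gradient. *)
definition H10 :: "(real^2) set \<Rightarrow> (real^2 \<Rightarrow> real) set" where
  "H10 \<Omega> = {\<phi> \<in> H1 \<Omega>. \<exists>g\<in>L2 \<Omega>. has_weak_grad \<Omega> \<phi> g \<and>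
     (\<forall>\<epsilon>>0. \<exists>\<eta>\<in>C1c \<Omega>.
        sqrt (\<integral>x. (\<phi> x - \<eta> x)\<^sup>2 + (norm (g x - grad \<eta> x))\<^sup>2 \<partial>lebesgue_on \<Omega>) < \<epsilon>)}"

(* A weak gradient is only determined almost everywhere; each of its versions is included. *)
definition G0 :: "(real^2) set \<Rightarrow> (real^2 \<Rightarrow> real^2) set" where
  "G0 \<Omega> = {g \<in> L2 \<Omega>. \<exists>\<phi>\<in>H10 \<Omega>. has_weak_grad \<Omega> \<phi> g}"

definition Curl0 :: "(real^2) set \<Rightarrow> (real^2 \<Rightarrow> real^2) set" where
  "Curl0 \<Omega> = {(\<lambda>x. perp (g x)) |g. g \<in> L2 \<Omega> \<and> (\<exists>\<psi>\<in>H10 \<Omega>. has_weak_grad \<Omega> \<psi> g)}"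

definition irrotational :: "(real^2) set \<Rightarrow> (real^2 \<Rightarrow> real^2) \<Rightarrow> bool" where
  "irrotational \<Omega> v \<longleftrightarrow> (\<forall>\<phi>\<in>C1c \<Omega>. (\<integral>x. perp_grad \<phi> x \<bullet> v x \<partial>lebesgue_on \<Omega>) = 0)"

definition solenoidal :: "(real^2) set \<Rightarrow> (real^2 \<Rightarrow> real^2) \<Rightarrow> bool" where
  "solenoidal \<Omega> v \<longleftrightarrow> (\<forall>\<phi>\<in>C1c \<Omega>. (\<integral>x. grad \<phi> x \<bullet> v x \<partial>lebesgue_on \<Omega>) = 0)"

definition N_curl :: "(real^2) set \<Rightarrow> (real^2 \<Rightarrow> real^2) set" where
  "N_curl \<Omega> = {v \<in> L2 \<Omega>. irrotational \<Omega> v}"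

definition N_div :: "(real^2) set \<Rightarrow> (real^2 \<Rightarrow> real^2) set" where
  "N_div \<Omega> = {v \<in> L2 \<Omega>. solenoidal \<Omega> v}"

definition harmonic_fields :: "(real^2) set \<Rightarrow> (real^2 \<Rightarrow> real^2) set" where
  "harmonic_fields \<Omega> = {v \<in> L2 \<Omega>. irrotational \<Omega> v \<and> solenoidal \<Omega> v}"

end

theory Submission
  imports Defs
begin

text \<open>
  The idea is that \<open>G0 \<Omega>\<close> is the closure in \<open>L2\<close> of the set \<open>V\<close> of gradients of \<open>C1c\<close> functions
  (\<open>G0_imp_limit_of_gradients\<close>, \<open>limit_of_gradients_imp_G0\<close>), while \<open>N_div \<Omega>\<close> is by definition the
  orthogonal complement of \<open>V\<close>. The decomposition into \<open>G0 \<Omega>\<close> and \<open>N_div \<Omega>\<close> is then the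
  projection theorem of Hilbert space theory. Both inclusions behind the description of \<open>G0 \<Omega>\<close> have
  content. A limit of gradients of \<open>\<eta> n\<close> is a gradient because the Poincare inequality makes \<open>\<eta>\<close> itself a
  Cauchy sequence, which converges by the Riesz--Fischer theorem. Conversely, every
  version of a weak gradient is such a limit because weak gradients are unique almost everywhere, by the
  fundamental lemma of the calculus of variations.

  The rotation \<open>perp\<close> is an isometry that maps \<open>G0 \<Omega>\<close> onto \<open>Curl0 \<Omega>\<close> and \<open>N_div \<Omega>\<close> onto
  \<open>N_curl \<Omega>\<close>, so the decomposition into \<open>Curl0 \<Omega>\<close> and \<open>N_curl \<Omega>\<close> is the rotated form of the first one.

  For the third decomposition, gradients are irrotational (\<open>G0_subset_N_curl\<close>), that is, \<open>G0 \<Omega>\<close>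
  is orthogonal to \<open>Curl0 \<Omega>\<close>. Splitting a field into \<open>c \<in> Curl0 \<Omega>\<close> and an irrotational rest, and the rest
  into \<open>g \<in> G0 \<Omega>\<close> and a solenoidal field, leaves a field which is solenoidal by construction
  and irrotational as a difference of irrotational fields, hence harmonic. That gradients are irrotational is
  the symmetry of second derivatives, which a \<open>C1\<close> function need not possess; the weak form that is needed,
  \<open>integral_grad_grad_commute\<close>, follows by moving difference quotients from one factor to the other.

  Uniqueness of the components follows from orthogonality alone.
\<close>

section \<open>Square integrable functions\<close>

definition square_integrable :: "'a measure \<Rightarrow> ('a \<Rightarrow> 'b::euclidean_space) \<Rightarrow> bool" where
  "square_integrable M f \<longleftrightarrow> f \<in> borel_measurable M \<and> integrable M (\<lambda>x. (norm (f x))\<^sup>2)"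

definition tends_in_mean_square ::
    "'a measure \<Rightarrow> (nat \<Rightarrow> 'a \<Rightarrow> 'b::euclidean_space) \<Rightarrow> ('a \<Rightarrow> 'b) \<Rightarrow> bool" where
  "tends_in_mean_square M F f \<longleftrightarrow> (\<lambda>n. \<integral>x. (norm (F n x - f x))\<^sup>2 \<partial>M) \<longlonglongrightarrow> 0"

text \<open>
  The triangle inequality in the form that survives integration without taking square roots.
\<close>
lemma norm_add_square_le: "(norm (a + b))\<^sup>2 \<le> 2 * (norm a)\<^sup>2 + 2 * (norm (b::'b::real_inner))\<^sup>2"
proof -
  have "2 * (norm a)\<^sup>2 + 2 * (norm b)\<^sup>2 - (norm (a + b))\<^sup>2 = (norm (a - b))\<^sup>2"
    by (simp add: power2_norm_eq_inner inner_add inner_diff inner_commute)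
  then show ?thesis by (smt (verit) zero_le_power2)
qed

lemma norm_diff_square_le: "(norm (a - b))\<^sup>2 \<le> 2 * (norm a)\<^sup>2 + 2 * (norm (b::'b::real_inner))\<^sup>2"
  using norm_add_square_le[of a "-b"] by simp

lemma square_integrable_measurable [measurable_dest]:
  "square_integrable M f \<Longrightarrow> f \<in> borel_measurable M"
  by (simp add: square_integrable_def)

lemma square_integrable_norm_square:
  "square_integrable M f \<Longrightarrow> integrable M (\<lambda>x. (norm (f x))\<^sup>2)"
  by (simp add: square_integrable_def)

lemma square_integrable_add:
  assumes "square_integrable M f" "square_integrable M g"
  shows "square_integrable M (\<lambda>x. f x + g x)"
proof -
  have [measurable]: "f \<in> borel_measurable M" "g \<in> borel_measurable M"
    using assms by (auto simp: square_integrable_def)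
  have "integrable M (\<lambda>x. 2 * (norm (f x))\<^sup>2 + 2 * (norm (g x))\<^sup>2)"
    using assms by (auto simp: square_integrable_def)
  then have "integrable M (\<lambda>x. (norm (f x + g x))\<^sup>2)"
    by (rule Bochner_Integration.integrable_bound) (auto simp: norm_add_square_le)
  then show ?thesis by (simp add: square_integrable_def)
qed

lemma square_integrable_scaleR:
  "square_integrable M f \<Longrightarrow> square_integrable M (\<lambda>x. c *\<^sub>R f x)"
  by (auto simp: square_integrable_def power_mult_distrib)

lemma square_integrable_diff:
  "square_integrable M f \<Longrightarrow> square_integrable M g \<Longrightarrow> square_integrable M (\<lambda>x. f x - g x)"
  using square_integrable_add[of M f "\<lambda>x. (-1) *\<^sub>R g x"] square_integrable_scaleR[of M g "-1"]
  by simp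

lemma square_integrable_norm_le:
  assumes "square_integrable M f" "g \<in> borel_measurable M" "\<And>x. norm (g x) \<le> norm (f x)"
  shows "square_integrable M g"
  unfolding square_integrable_def
proof
  have [measurable]: "g \<in> borel_measurable M" by fact
  show "g \<in> borel_measurable M" by fact
  show "integrable M (\<lambda>x. (norm (g x))\<^sup>2)"
    by (rule Bochner_Integration.integrable_bound[OF square_integrable_norm_square[OF assms(1)]])
       (auto intro!: power_mono assms(3))
qed

lemma square_integrable_nth:
  fixes f :: "'a \<Rightarrow> real^'n"
  assumes "square_integrable M f"
  shows "square_integrable M (\<lambda>x. f x $ j)"
proof (rule square_integrable_norm_le[OF assms])
  have [measurable]: "f \<in> borel_measurable M" using assms by (simp add: square_integrable_def)
  have "(\<lambda>x. f x \<bullet> axis j 1) \<in> borel_measurable M" by measurable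
  then show "(\<lambda>x. f x $ j) \<in> borel_measurable M" by (simp add: inner_axis)
  show "norm (f x $ j) \<le> norm (f x)" for x using component_le_norm_cart[of "f x" j] by simp
qed

lemma integrable_inner_square_integrable:
  assumes "square_integrable M f" "square_integrable M g"
  shows "integrable M (\<lambda>x. f x \<bullet> g x)"
proof -
  have [measurable]: "f \<in> borel_measurable M" "g \<in> borel_measurable M"
    using assms by (auto simp: square_integrable_def)
  have "integrable M (\<lambda>x. (norm (f x))\<^sup>2 + (norm (g x))\<^sup>2)"
    using assms by (auto simp: square_integrable_def)
  then show ?thesis
  proof (rule Bochner_Integration.integrable_bound)
    have "norm (f x \<bullet> g x) \<le> norm ((norm (f x))\<^sup>2 + (norm (g x))\<^sup>2)" for x
    proof -
      have "\<bar>f x \<bullet> g x\<bar> \<le> norm (f x) * norm (g x)" by (rule Cauchy_Schwarz_ineq2)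
      also have "\<dots> \<le> (norm (f x))\<^sup>2 + (norm (g x))\<^sup>2"
        using sum_squares_bound[of "norm (f x)" "norm (g x)"]
          mult_nonneg_nonneg[OF norm_ge_zero[of "f x"] norm_ge_zero[of "g x"]] by linarith
      finally show ?thesis by simp
    qed
    then show "AE x in M. norm (f x \<bullet> g x) \<le> norm ((norm (f x))\<^sup>2 + (norm (g x))\<^sup>2)" by simp
  qed measurable
qed

text \<open>
  The squared distance along a line is a quadratic polynomial. Both the Cauchy--Schwarz inequality
  and the variational characterisation of the projection are read off from it.
\<close>
lemma integral_norm_square_add_scaleR:
  fixes f g :: "'a \<Rightarrow> 'b::euclidean_space"
  assumes "square_integrable M f" "square_integrable M g"
  shows "(\<integral>x. (norm (f x + t *\<^sub>R g x))\<^sup>2 \<partial>M) =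
         (\<integral>x. (norm (f x))\<^sup>2 \<partial>M) + 2 * t * (\<integral>x. f x \<bullet> g x \<partial>M) + t\<^sup>2 * (\<integral>x. (norm (g x))\<^sup>2 \<partial>M)"
proof -
  note i = square_integrable_norm_square[OF assms(1)] square_integrable_norm_square[OF assms(2)]
    integrable_inner_square_integrable[OF assms]
  have "(norm (a + t *\<^sub>R b))\<^sup>2 = (norm a)\<^sup>2 + 2 * t * (a \<bullet> b) + t\<^sup>2 * (norm b)\<^sup>2" for a b :: 'b
    unfolding power2_norm_eq_inner
    by (simp add: inner_add inner_commute[of b a] algebra_simps power2_eq_square[of t] del: dot_square_norm)
  then have "(\<integral>x. (norm (f x + t *\<^sub>R g x))\<^sup>2 \<partial>M) =
        (\<integral>x. (norm (f x))\<^sup>2 + 2 * t * (f x \<bullet> g x) + t\<^sup>2 * (norm (g x))\<^sup>2 \<partial>M)"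
    by simp
  then show ?thesis using i by simp
qed

lemma nonneg_quadratic_discriminant:
  fixes a b c :: real
  assumes "0 \<le> a" "\<And>t. 0 \<le> c + 2 * t * b + t\<^sup>2 * a"
  shows "b\<^sup>2 \<le> c * a"
proof (cases "a = 0")
  case True
  have "b = 0"
  proof (rule ccontr)
    assume "b \<noteq> 0"
    then show False using assms(2)[of "- (c + 1) / (2 * b)"] True by (simp add: field_simps)
  qed
  then show ?thesis using True by simp
next
  case False
  with \<open>0 \<le> a\<close> have "a > 0" by simp
  then show ?thesis using assms(2)[of "- b / a"] by (simp add: field_simps power2_eq_square)
qed

lemma integral_inner_Cauchy_Schwarz:
  assumes "square_integrable M f" "square_integrable M g"
  shows "(\<integral>x. f x \<bullet> g x \<partial>M)\<^sup>2 \<le> (\<integral>x. (norm (f x))\<^sup>2 \<partial>M) * (\<integral>x. (norm (g x))\<^sup>2 \<partial>M)"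
  by (rule nonneg_quadratic_discriminant)
     (simp, simp only: integral_norm_square_add_scaleR[OF assms, symmetric], simp)

lemma tends_in_mean_square_integral_inner:
  assumes "tends_in_mean_square M F f" "\<And>n. square_integrable M (F n)" "square_integrable M f"
    and "square_integrable M v"
  shows "(\<lambda>n. \<integral>x. F n x \<bullet> v x \<partial>M) \<longlonglongrightarrow> (\<integral>x. f x \<bullet> v x \<partial>M)"
proof -
  define e where "e n = (\<integral>x. F n x \<bullet> v x \<partial>M) - (\<integral>x. f x \<bullet> v x \<partial>M)" for n
  have e: "(e n)\<^sup>2 \<le> (\<integral>x. (norm (F n x - f x))\<^sup>2 \<partial>M) * (\<integral>x. (norm (v x))\<^sup>2 \<partial>M)" for n
  proof -
    have "e n = (\<integral>x. (F n x - f x) \<bullet> v x \<partial>M)"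
      using assms by (simp add: e_def inner_diff_left integrable_inner_square_integrable)
    then show ?thesis
      using integral_inner_Cauchy_Schwarz[OF square_integrable_diff[OF assms(2,3)] assms(4)] by simp
  qed
  have "(\<lambda>n. (\<integral>x. (norm (F n x - f x))\<^sup>2 \<partial>M) * (\<integral>x. (norm (v x))\<^sup>2 \<partial>M)) \<longlonglongrightarrow> 0"
    using assms(1) unfolding tends_in_mean_square_def by (rule tendsto_mult_left_zero)
  then have "(\<lambda>n. (e n)\<^sup>2) \<longlonglongrightarrow> 0"
    by (rule tendsto_sandwich[OF _ _ tendsto_const, rotated 2]) (use e in auto)
  then have "e \<longlonglongrightarrow> 0" by (simp add: power_tendsto_0_iff)
  then show ?thesis unfolding e_def by (simp add: LIM_zero_iff)
qed

lemma tends_in_mean_square_add: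
  assumes "tends_in_mean_square M F f" "tends_in_mean_square M G g"
    and "\<And>n. square_integrable M (F n)" "square_integrable M f"
    and "\<And>n. square_integrable M (G n)" "square_integrable M g"
  shows "tends_in_mean_square M (\<lambda>n x. F n x + G n x) (\<lambda>x. f x + g x)"
proof -
  note d = square_integrable_diff[OF assms(3,4)] square_integrable_diff[OF assms(5,6)]
  have "(\<integral>x. (norm (F n x + G n x - (f x + g x)))\<^sup>2 \<partial>M)
      \<le> 2 * (\<integral>x. (norm (F n x - f x))\<^sup>2 \<partial>M) + 2 * (\<integral>x. (norm (G n x - g x))\<^sup>2 \<partial>M)" for n
  proof -
    have "(\<integral>x. (norm (F n x + G n x - (f x + g x)))\<^sup>2 \<partial>M) =
          (\<integral>x. (norm ((F n x - f x) + (G n x - g x)))\<^sup>2 \<partial>M)" by (simp add: algebra_simps)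
    also have "\<dots> \<le> (\<integral>x. 2 * (norm (F n x - f x))\<^sup>2 + 2 * (norm (G n x - g x))\<^sup>2 \<partial>M)"
      by (rule integral_mono)
         (auto intro!: square_integrable_norm_square square_integrable_add d norm_add_square_le
            Bochner_Integration.integrable_add integrable_mult_right)
    also have "\<dots> = 2 * (\<integral>x. (norm (F n x - f x))\<^sup>2 \<partial>M) + 2 * (\<integral>x. (norm (G n x - g x))\<^sup>2 \<partial>M)"
      using d[THEN square_integrable_norm_square] by simp
    finally show ?thesis .
  qed
  moreover have lim: "(\<lambda>n. 2 * (\<integral>x. (norm (F n x - f x))\<^sup>2 \<partial>M)
      + 2 * (\<integral>x. (norm (G n x - g x))\<^sup>2 \<partial>M)) \<longlonglongrightarrow> 2 * 0 + 2 * 0"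
    using assms(1,2) unfolding tends_in_mean_square_def by (intro tendsto_intros)
  ultimately show ?thesis unfolding tends_in_mean_square_def
    by (intro tendsto_sandwich[OF _ _ tendsto_const lim[simplified]]) simp_all
qed

lemma tends_in_mean_square_scaleR:
  assumes "tends_in_mean_square M F f"
  shows "tends_in_mean_square M (\<lambda>n x. c *\<^sub>R F n x) (\<lambda>x. c *\<^sub>R f x)"
proof -
  have "(\<lambda>n. c\<^sup>2 * (\<integral>x. (norm (F n x - f x))\<^sup>2 \<partial>M)) \<longlonglongrightarrow> 0"
    using assms unfolding tends_in_mean_square_def by (rule tendsto_mult_right_zero)
  then show ?thesis
    by (simp add: tends_in_mean_square_def power_mult_distrib flip: scaleR_diff_right)
qed

lemma tends_in_mean_square_cong_AE:
  assumes "tends_in_mean_square M F f" "AE x in M. f x = g x"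
    and "\<And>n. square_integrable M (F n)" "square_integrable M f" "square_integrable M g"
  shows "tends_in_mean_square M F g"
proof -
  have "(\<integral>x. (norm (F n x - g x))\<^sup>2 \<partial>M) = (\<integral>x. (norm (F n x - f x))\<^sup>2 \<partial>M)" for n
  proof (rule integral_cong_AE)
    show "(\<lambda>x. (norm (F n x - g x))\<^sup>2) \<in> borel_measurable M"
      by (intro borel_measurable_integrable square_integrable_norm_square square_integrable_diff assms)
    show "(\<lambda>x. (norm (F n x - f x))\<^sup>2) \<in> borel_measurable M"
      by (intro borel_measurable_integrable square_integrable_norm_square square_integrable_diff assms)
    show "AE x in M. (norm (F n x - g x))\<^sup>2 = (norm (F n x - f x))\<^sup>2"
      using assms(2) by eventually_elim simp
  qed
  then show ?thesis using assms(1) by (simp add: tends_in_mean_square_def)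
qed

text \<open>
  On a space of finite measure the square integrals control the integrals, so the series of the
  increments has a finite integral and hence converges absolutely almost everywhere.
\<close>
lemma AE_convergent_of_rapidly_Cauchy:
  fixes F :: "nat \<Rightarrow> 'a \<Rightarrow> 'b::euclidean_space"
  assumes "finite_measure M" and sq: "\<And>n. square_integrable M (F n)"
    and fast: "\<And>k. (\<integral>x. (norm (F (Suc k) x - F k x))\<^sup>2 \<partial>M) \<le> (1/4) ^ k"
  shows "AE x in M. convergent (\<lambda>k. F k x)"
proof -
  interpret finite_measure M by fact
  define D where "D k x = norm (F (Suc k) x - F k x)" for k x
  have F[measurable]: "F n \<in> borel_measurable M" for n using sq by (simp add: square_integrable_def)
  have D[measurable]: "D k \<in> borel_measurable M" for k unfolding D_def by measurable
  have Dnn: "0 \<le> D k x" for k x by (simp add: D_def)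
  have iD2: "integrable M (\<lambda>x. (D k x)\<^sup>2)" for k
    unfolding D_def by (intro square_integrable_norm_square square_integrable_diff sq)
  \<comment> \<open>with these weights both terms have an integral of order \<open>2^-k\<close>, which is summable\<close>
  have ptw: "D k x \<le> 2 ^ k * (D k x)\<^sup>2 + (1/2) ^ k" for k x
  proof -
    have "0 \<le> (1/2) ^ k * (2 ^ k * D k x - 1 / 2)\<^sup>2" by simp
    also have "\<dots> = 2 ^ k * (D k x)\<^sup>2 - D k x + (1/2) ^ k / 4"
      by (simp add: power2_eq_square field_simps power_one_over)
    finally show ?thesis using zero_less_power[of "1/2::real" k] by linarith
  qed
  have iD: "integrable M (D k)" for k
    by (rule Bochner_Integration.integrable_bound[where f="\<lambda>x. 2 ^ k * (D k x)\<^sup>2 + (1/2) ^ k"])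
       (use ptw Dnn iD2 in auto)
  have le: "(\<integral>x. D k x \<partial>M) \<le> (1/2) ^ k * (1 + measure M (space M))" for k
  proof -
    have "(\<integral>x. D k x \<partial>M) \<le> (\<integral>x. 2 ^ k * (D k x)\<^sup>2 + (1/2) ^ k \<partial>M)"
      by (rule integral_mono) (use iD iD2 ptw in auto)
    also have "\<dots> = 2 ^ k * (\<integral>x. (D k x)\<^sup>2 \<partial>M) + (1/2) ^ k * measure M (space M)"
      using iD2 by (simp add: mult.commute)
    also have "\<dots> \<le> 2 ^ k * (1/4) ^ k + (1/2) ^ k * measure M (space M)"
      using fast[of k] by (simp add: D_def)
    also have "\<dots> = (1/2) ^ k * (1 + measure M (space M))"
      by (simp add: algebra_simps flip: power_mult_distrib)
    finally show ?thesis .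
  qed
  have "(\<integral>\<^sup>+x. (\<Sum>k. ennreal (D k x)) \<partial>M) = (\<Sum>k. \<integral>\<^sup>+x. ennreal (D k x) \<partial>M)"
    by (rule nn_integral_suminf) measurable
  also have "\<dots> = (\<Sum>k. ennreal (\<integral>x. D k x \<partial>M))"
    by (intro suminf_cong nn_integral_eq_integral iD) (auto simp: D_def)
  also have "\<dots> \<le> (\<Sum>k. ennreal ((1/2) ^ k * (1 + measure M (space M))))"
    by (intro suminf_le ennreal_leI le) auto
  also have "\<dots> < \<infinity>"
    by (subst suminf_ennreal2) (auto intro!: summable_mult2 summable_geometric add_nonneg_nonneg)
  finally have "(\<integral>\<^sup>+x. (\<Sum>k. ennreal (D k x)) \<partial>M) \<noteq> \<infinity>" by simp
  then have "AE x in M. (\<Sum>k. ennreal (D k x)) \<noteq> \<infinity>"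
    by (intro nn_integral_noteq_infinite) auto
  then show ?thesis
  proof eventually_elim
    case (elim x)
    have "summable (\<lambda>k. D k x)"
      by (rule summable_suminf_not_top) (use elim in \<open>auto simp: D_def\<close>)
    then have "summable (\<lambda>k. F (Suc k) x - F k x)" unfolding D_def by (rule summable_norm_cancel)
    then have "convergent (\<lambda>n. \<Sum>k<n. F (Suc k) x - F k x)" by (simp add: summable_iff_convergent)
    then have "convergent (\<lambda>n. F n x - F 0 x)" by (simp add: sum_lessThan_telescope[of "\<lambda>k. F k x"])
    then obtain l where "(\<lambda>n. F n x - F 0 x) \<longlonglongrightarrow> l" by (auto simp: convergent_def)
    then have "(\<lambda>n. (F n x - F 0 x) + F 0 x) \<longlonglongrightarrow> l + F 0 x" by (intro tendsto_intros)
    then show ?case by (auto simp: convergent_def)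
  qed
qed

text \<open>
  A rapidly Cauchy subsequence converges almost everywhere. Fatou's lemma, applied along this
  subsequence to the distance from a fixed member, shows that its limit attracts the whole sequence.
\<close>
lemma Riesz_Fischer:
  fixes F :: "nat \<Rightarrow> 'a \<Rightarrow> 'b::euclidean_space"
  assumes fin: "finite_measure M" and sq: "\<And>n. square_integrable M (F n)"
    and Cauchy: "\<And>e. e > 0 \<Longrightarrow> \<exists>N. \<forall>m\<ge>N. \<forall>n\<ge>N. (\<integral>x. (norm (F m x - F n x))\<^sup>2 \<partial>M) \<le> e"
  obtains f where "square_integrable M f" "tends_in_mean_square M F f"
proof -
  have "\<forall>k. \<exists>N. \<forall>m\<ge>N. \<forall>n\<ge>N. (\<integral>x. (norm (F m x - F n x))\<^sup>2 \<partial>M) \<le> (1/4) ^ k"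
    using Cauchy by simp
  from choice[OF this] obtain N
    where N: "\<And>k m n. m \<ge> N k \<Longrightarrow> n \<ge> N k \<Longrightarrow> (\<integral>x. (norm (F m x - F n x))\<^sup>2 \<partial>M) \<le> (1/4) ^ k"
    by blast
  \<comment> \<open>the sum makes \<open>r k\<close> and \<open>r (Suc k)\<close> at least \<open>N k\<close>, and the summand \<open>k\<close> makes \<open>r\<close> tend to infinity\<close>
  define r where "r k = k + (\<Sum>i\<le>k. N i)" for k
  have rN: "N k \<le> r k" "N k \<le> r (Suc k)" for k
    using member_le_sum[of k "{..k}" N] by (auto simp: r_def)
  have rk: "k \<le> r k" for k by (simp add: r_def)
  have F[measurable]: "F n \<in> borel_measurable M" for n using sq by (simp add: square_integrable_def)
  have conv: "AE x in M. convergent (\<lambda>k. F (r k) x)"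
    by (rule AE_convergent_of_rapidly_Cauchy[OF fin]) (auto intro: sq N rN)
  define f where "f x = lim (\<lambda>k. F (r k) x)" for x
  have f[measurable]: "f \<in> borel_measurable M"
    unfolding f_def by (rule borel_measurable_lim_metric) simp
  have bound: "(\<integral>\<^sup>+x. ennreal ((norm (F n x - f x))\<^sup>2) \<partial>M) \<le> ennreal e"
    if e: "\<forall>m\<ge>K. (\<integral>x. (norm (F m x - F n x))\<^sup>2 \<partial>M) \<le> e" for K n e
  proof -
    have "(\<integral>\<^sup>+x. ennreal ((norm (F n x - f x))\<^sup>2) \<partial>M) =
          (\<integral>\<^sup>+x. liminf (\<lambda>k. ennreal ((norm (F n x - F (r k) x))\<^sup>2)) \<partial>M)"
    proof (rule nn_integral_cong_AE)
      show "AE x in M. ennreal ((norm (F n x - f x))\<^sup>2)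
          = liminf (\<lambda>k. ennreal ((norm (F n x - F (r k) x))\<^sup>2))"
        using conv
      proof eventually_elim
        case (elim x)
        then have "(\<lambda>k. F (r k) x) \<longlonglongrightarrow> f x" by (simp add: f_def convergent_LIMSEQ_iff)
        then have "(\<lambda>k. ennreal ((norm (F n x - F (r k) x))\<^sup>2)) \<longlonglongrightarrow> ennreal ((norm (F n x - f x))\<^sup>2)"
          by (intro tendsto_intros)
        then show ?case by (intro lim_imp_Liminf[symmetric]) auto
      qed
    qed
    also have "\<dots> \<le> liminf (\<lambda>k. \<integral>\<^sup>+x. ennreal ((norm (F n x - F (r k) x))\<^sup>2) \<partial>M)"
      by (rule nn_integral_liminf) measurable
    also have "\<dots> \<le> ennreal e"
    proof (rule Liminf_le)
      have "(\<integral>\<^sup>+x. ennreal ((norm (F n x - F (r k) x))\<^sup>2) \<partial>M) \<le> ennreal e" if "k \<ge> K" for k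
      proof -
        have "(\<integral>\<^sup>+x. ennreal ((norm (F n x - F (r k) x))\<^sup>2) \<partial>M)
            = ennreal (\<integral>x. (norm (F n x - F (r k) x))\<^sup>2 \<partial>M)"
          by (intro nn_integral_eq_integral square_integrable_norm_square square_integrable_diff sq) simp
        also have "\<dots> \<le> ennreal e"
          using e[rule_format, of "r k"] that rk[of k]
          by (intro ennreal_leI) (simp add: norm_minus_commute[of "F n _"])
        finally show ?thesis .
      qed
      then show "\<forall>\<^sub>F k in sequentially. (\<integral>\<^sup>+x. ennreal ((norm (F n x - F (r k) x))\<^sup>2) \<partial>M) \<le> ennreal e"
        by (auto simp: eventually_sequentially)
    qed simp
    finally show ?thesis .
  qed
  have diff: "square_integrable M (\<lambda>x. F n x - f x)"
    if e: "\<forall>m\<ge>K. (\<integral>x. (norm (F m x - F n x))\<^sup>2 \<partial>M) \<le> e" for K n e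
  proof -
    have "(\<integral>\<^sup>+x. ennreal (norm ((norm (F n x - f x))\<^sup>2)) \<partial>M) < \<infinity>"
      using le_less_trans[OF bound[OF e] ennreal_less_top] by simp
    then have "integrable M (\<lambda>x. (norm (F n x - f x))\<^sup>2)"
      by (intro integrableI_bounded) auto
    then show ?thesis by (simp add: square_integrable_def)
  qed
  obtain K where K: "\<forall>m\<ge>K. \<forall>n\<ge>K. (\<integral>x. (norm (F m x - F n x))\<^sup>2 \<partial>M) \<le> 1"
    using Cauchy[of 1] by auto
  have "square_integrable M f"
    using square_integrable_diff[OF sq[of K] diff[of K K 1]] K by simp
  moreover have "tends_in_mean_square M F f"
    unfolding tends_in_mean_square_def
  proof (rule LIMSEQ_I)
    fix e :: real assume "e > 0"
    then obtain K where K: "\<forall>m\<ge>K. \<forall>n\<ge>K. (\<integral>x. (norm (F m x - F n x))\<^sup>2 \<partial>M) \<le> e / 2"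
      using Cauchy[of "e/2"] by auto
    have "norm ((\<integral>x. (norm (F n x - f x))\<^sup>2 \<partial>M) - 0) < e" if "n \<ge> K" for n
    proof -
      have h: "\<forall>m\<ge>K. (\<integral>x. (norm (F m x - F n x))\<^sup>2 \<partial>M) \<le> e / 2" using K that by simp
      have "ennreal (\<integral>x. (norm (F n x - f x))\<^sup>2 \<partial>M) = (\<integral>\<^sup>+x. ennreal ((norm (F n x - f x))\<^sup>2) \<partial>M)"
        by (intro nn_integral_eq_integral[symmetric] square_integrable_norm_square diff[OF h]) simp
      then have "ennreal (\<integral>x. (norm (F n x - f x))\<^sup>2 \<partial>M) \<le> ennreal (e / 2)" using bound[OF h] by simp
      then show ?thesis using \<open>e > 0\<close> by (simp add: ennreal_le_iff)
    qed
    then show "\<exists>no. \<forall>n\<ge>no. norm ((\<integral>x. (norm (F n x - f x))\<^sup>2 \<partial>M) - 0) < e" by blast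
  qed
  ultimately show ?thesis using that by blast
qed

lemma parallelogram_law:
  "(norm (a + b))\<^sup>2 + (norm (a - b))\<^sup>2 = 2 * (norm a)\<^sup>2 + 2 * (norm (b::'b::real_inner))\<^sup>2"
  by (simp add: power2_norm_eq_inner inner_add inner_diff inner_commute)

text \<open>
  By the parallelogram law a sequence in \<open>V\<close> that minimises the distance to \<open>w\<close> is Cauchy; its limit
  has minimal distance, so the derivative of the squared distance in each direction from \<open>V\<close> vanishes there.
\<close>
lemma projection_onto_mean_square_closure:
  fixes V :: "('a \<Rightarrow> 'b::euclidean_space) set"
  assumes fin: "finite_measure M" and w: "square_integrable M w"
    and V: "V \<noteq> {}" "\<And>v. v \<in> V \<Longrightarrow> square_integrable M v"
      "\<And>u v c. u \<in> V \<Longrightarrow> v \<in> V \<Longrightarrow> (\<lambda>x. u x + c *\<^sub>R v x) \<in> V"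
      "\<And>v c. v \<in> V \<Longrightarrow> (\<lambda>x. c *\<^sub>R v x) \<in> V"
  obtains F g where "\<And>n. F n \<in> V" "square_integrable M g" "tends_in_mean_square M F g"
    "\<And>v. v \<in> V \<Longrightarrow> (\<integral>x. (w x - g x) \<bullet> v x \<partial>M) = 0"
proof -
  define J where "J v = (\<integral>x. (norm (w x - v x))\<^sup>2 \<partial>M)" for v
  define d where "d = (INF v\<in>V. J v)"
  have bdd: "bdd_below (J ` V)" by (rule bdd_belowI[of _ 0]) (auto simp: J_def)
  have dle: "d \<le> J v" if "v \<in> V" for v
    unfolding d_def by (rule cINF_lower[OF bdd that])
  have "\<forall>n. \<exists>v. v \<in> V \<and> J v < d + 1 / real (Suc n)"
  proof
    fix n
    have "(INF v\<in>V. J v) < d + 1 / real (Suc n)" by (simp add: d_def)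
    then show "\<exists>v. v \<in> V \<and> J v < d + 1 / real (Suc n)"
      using cINF_less_iff[OF V(1) bdd] by blast
  qed
  from choice[OF this] obtain F where F: "\<And>n. F n \<in> V" "\<And>n. J (F n) < d + 1 / real (Suc n)"
    by blast
  note sqF = V(2)[OF F(1)]
  have close: "(\<integral>x. (norm (F m x - F n x))\<^sup>2 \<partial>M) \<le> 2 / real (Suc m) + 2 / real (Suc n)" for m n
  proof -
    \<comment> \<open>the midpoint lies in \<open>V\<close>, so it is not closer to \<open>w\<close> than \<open>d\<close> allows\<close>
    define h where "h x = (1/2) *\<^sub>R F m x + (1/2) *\<^sub>R F n x" for x
    have h: "h \<in> V" unfolding h_def by (intro V(3) V(4) F)
    note sqh = V(2)[OF h]
    note i = square_integrable_norm_square[OF square_integrable_diff[OF w sqF]]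
      square_integrable_norm_square[OF square_integrable_diff[OF w sqh]]
    have "(norm (F m x - F n x))\<^sup>2 = 2 * (norm (w x - F m x))\<^sup>2 + 2 * (norm (w x - F n x))\<^sup>2
        - 4 * (norm (w x - h x))\<^sup>2" for x
    proof -
      have "(w x - F m x) + (w x - F n x) = 2 *\<^sub>R (w x - h x)"
        by (simp add: h_def algebra_simps scaleR_2)
      then have "(norm ((w x - F m x) + (w x - F n x)))\<^sup>2 = 4 * (norm (w x - h x))\<^sup>2"
        by (simp add: power_mult_distrib)
      moreover have "(norm ((w x - F m x) - (w x - F n x)))\<^sup>2 = (norm (F m x - F n x))\<^sup>2"
        by (simp add: norm_minus_commute)
      ultimately show ?thesis
        using parallelogram_law[of "w x - F m x" "w x - F n x"] by simp
    qed
    then have "(\<integral>x. (norm (F m x - F n x))\<^sup>2 \<partial>M) = 2 * J (F m) + 2 * J (F n) - 4 * J h"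
      using i by (simp add: J_def)
    then show ?thesis using F(2)[of m] F(2)[of n] dle[OF h] by simp
  qed
  have Cauchy: "\<exists>N. \<forall>m\<ge>N. \<forall>n\<ge>N. (\<integral>x. (norm (F m x - F n x))\<^sup>2 \<partial>M) \<le> e" if e: "e > 0" for e
  proof -
    obtain N where "inverse (real (Suc N)) < e / 4"
      using reals_Archimedean[of "e / 4"] e by auto
    then have N: "4 / real (Suc N) < e" by (simp add: field_simps)
    have "(\<integral>x. (norm (F m x - F n x))\<^sup>2 \<partial>M) \<le> e" if "m \<ge> N" "n \<ge> N" for m n
    proof -
      have "2 / real (Suc m) \<le> 2 / real (Suc N)" "2 / real (Suc n) \<le> 2 / real (Suc N)"
        using that by (auto intro!: divide_left_mono)
      then show ?thesis using close[of m n] N by simp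
    qed
    then show ?thesis by blast
  qed
  obtain g where g: "square_integrable M g" "tends_in_mean_square M F g"
    using Riesz_Fischer[OF fin sqF Cauchy] by blast
  have "(\<integral>x. (w x - g x) \<bullet> v x \<partial>M) = 0" if v: "v \<in> V" for v
  proof -
    note sqv = V(2)[OF v]
    define a where "a = (\<integral>x. (norm (v x))\<^sup>2 \<partial>M)"
    define b where "b = (\<integral>x. (w x - g x) \<bullet> v x \<partial>M)"
    have split: "(\<integral>x. (w x - u x) \<bullet> v x \<partial>M) = (\<integral>x. w x \<bullet> v x \<partial>M) - (\<integral>x. u x \<bullet> v x \<partial>M)"
      if "square_integrable M u" for u
      using that w sqv by (simp add: inner_diff_left integrable_inner_square_integrable)
    have lim: "(\<lambda>n. \<integral>x. (w x - F n x) \<bullet> v x \<partial>M) \<longlonglongrightarrow> b"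
      unfolding b_def split[OF sqF] split[OF g(1)]
      by (intro tendsto_intros tends_in_mean_square_integral_inner g sqF sqv)
    \<comment> \<open>minimality of the distance in the direction \<open>v\<close>\<close>
    have min: "0 \<le> 1 / real (Suc n) + 2 * t * (\<integral>x. (w x - F n x) \<bullet> v x \<partial>M) + t\<^sup>2 * a" for t n
    proof -
      have "d \<le> J (\<lambda>x. F n x + (- t) *\<^sub>R v x)" by (intro dle V(3) F v)
      also have "\<dots> = (\<integral>x. (norm ((w x - F n x) + t *\<^sub>R v x))\<^sup>2 \<partial>M)"
        by (simp add: J_def algebra_simps)
      also have "\<dots> = J (F n) + 2 * t * (\<integral>x. (w x - F n x) \<bullet> v x \<partial>M) + t\<^sup>2 * a"
        unfolding J_def a_def
        by (rule integral_norm_square_add_scaleR[OF square_integrable_diff[OF w sqF] sqv])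
      finally show ?thesis using F(2)[of n] by simp
    qed
    have "0 \<le> 0 + 2 * t * b + t\<^sup>2 * a" for t
    proof (rule LIMSEQ_le_const)
      show "(\<lambda>n. 1 / real (Suc n) + 2 * t * (\<integral>x. (w x - F n x) \<bullet> v x \<partial>M) + t\<^sup>2 * a)
          \<longlonglongrightarrow> 0 + 2 * t * b + t\<^sup>2 * a"
        using LIMSEQ_inverse_real_of_nat
        by (intro tendsto_intros lim) (simp add: inverse_eq_divide)
      show "\<exists>N. \<forall>n\<ge>N. 0 \<le> 1 / real (Suc n) + 2 * t * (\<integral>x. (w x - F n x) \<bullet> v x \<partial>M) + t\<^sup>2 * a"
        using min by blast
    qed
    then have "b\<^sup>2 \<le> 0 * a" by (intro nonneg_quadratic_discriminant) (simp_all add: a_def)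
    then show ?thesis by (simp add: b_def)
  qed
  with F(1) g that show ?thesis by blast
qed

section \<open>Continuously differentiable functions with compact support\<close>

definition C1 :: "(real^2 \<Rightarrow> real) \<Rightarrow> bool" where
  "C1 u \<longleftrightarrow> (\<forall>x. u differentiable (at x)) \<and> continuous_on UNIV (grad u)"

lemma grad_eqI:
  assumes "(u has_derivative (\<lambda>h. g \<bullet> h)) (at x)"
  shows "grad u x = g"
  by (simp add: grad_def vec_eq_iff inner_axis flip: frechet_derivative_at[OF assms])

text \<open>
  This links the coordinatewise \<open>grad\<close> to the derivative, which is the form in which the
  derivative rules apply.
\<close>
lemma has_derivative_grad:
  assumes "u differentiable (at x)"
  shows "(u has_derivative (\<lambda>h. grad u x \<bullet> h)) (at x)"
proof -
  let ?D = "frechet_derivative u (at x)"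
  have D: "(u has_derivative ?D) (at x)" using assms by (simp add: frechet_derivative_works)
  then have lin: "linear ?D" by (rule has_derivative_linear)
  have "?D h = grad u x \<bullet> h" for h
  proof -
    have "?D h = ?D (\<Sum>j\<in>UNIV. h $ j *\<^sub>R axis j 1)"
      using basis_expansion[of h] by (simp add: scalar_mult_eq_scaleR)
    also have "\<dots> = (\<Sum>j\<in>UNIV. h $ j *\<^sub>R ?D (axis j 1))"
      by (simp add: linear_sum[OF lin] linear_cmul[OF lin])
    also have "\<dots> = grad u x \<bullet> h" by (simp add: grad_def inner_vec_def mult.commute)
    finally show ?thesis .
  qed
  then have "?D = (\<lambda>h. grad u x \<bullet> h)" by auto
  with D show ?thesis by simp
qed

lemma C1_has_derivative: "C1 u \<Longrightarrow> (u has_derivative (\<lambda>h. grad u x \<bullet> h)) (at x)"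
  by (simp add: C1_def has_derivative_grad)

lemma C1_continuous: "C1 u \<Longrightarrow> continuous_on UNIV u"
  by (meson C1_has_derivative continuous_at_imp_continuous_on has_derivative_continuous)

lemma C1_continuous_grad: "C1 u \<Longrightarrow> continuous_on UNIV (grad u)"
  by (simp add: C1_def)

lemma C1I:
  assumes "\<And>x. (u has_derivative (\<lambda>h. G x \<bullet> h)) (at x)" "continuous_on UNIV G"
  shows "C1 u" "grad u = G"
proof -
  show "grad u = G" using grad_eqI[OF assms(1)] by auto
  then show "C1 u" using assms by (auto simp: C1_def differentiable_def)
qed

lemma C1_const: "C1 (\<lambda>x. c)" and grad_const: "grad (\<lambda>x. c) = (\<lambda>x. 0)"
  by (rule C1I[where G="\<lambda>x. 0"]; auto intro!: derivative_eq_intros)+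

lemma C1_nth: "C1 (\<lambda>x. x $ j)" and grad_nth: "grad (\<lambda>x. x $ j) = (\<lambda>x. axis j 1)"
proof -
  have "((\<lambda>x::real^2. x $ j) has_derivative (\<lambda>h. axis j 1 \<bullet> h)) (at x)" for x
    using bounded_linear_imp_has_derivative[OF bounded_linear_vec_nth] by (simp add: inner_axis')
  from C1I[OF this continuous_on_const]
  show "C1 (\<lambda>x. x $ j)" "grad (\<lambda>x. x $ j) = (\<lambda>x. axis j 1)" by auto
qed

lemma
  assumes "C1 u" "C1 v"
  shows C1_add: "C1 (\<lambda>x. u x + v x)"
    and grad_add: "grad (\<lambda>x. u x + v x) = (\<lambda>x. grad u x + grad v x)"
proof -
  have d: "((\<lambda>x. u x + v x) has_derivative (\<lambda>h. (grad u x + grad v x) \<bullet> h)) (at x)" for x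
    using has_derivative_add[OF assms[THEN C1_has_derivative]] by (simp add: inner_add_left)
  have c: "continuous_on UNIV (\<lambda>x. grad u x + grad v x)"
    by (intro continuous_intros assms[THEN C1_continuous_grad])
  show "C1 (\<lambda>x. u x + v x)" "grad (\<lambda>x. u x + v x) = (\<lambda>x. grad u x + grad v x)"
    using C1I[OF d c] by auto
qed

lemma
  assumes "C1 u" "C1 v"
  shows C1_mult: "C1 (\<lambda>x. u x * v x)"
    and grad_mult: "grad (\<lambda>x. u x * v x) = (\<lambda>x. u x *\<^sub>R grad v x + v x *\<^sub>R grad u x)"
proof -
  have d: "((\<lambda>x. u x * v x) has_derivative (\<lambda>h. (u x *\<^sub>R grad v x + v x *\<^sub>R grad u x) \<bullet> h)) (at x)" for x
    using has_derivative_mult[OF assms[THEN C1_has_derivative]]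
    by (simp add: inner_add_left mult.commute)
  have c: "continuous_on UNIV (\<lambda>x. u x *\<^sub>R grad v x + v x *\<^sub>R grad u x)"
    by (intro continuous_intros assms[THEN C1_continuous_grad] assms[THEN C1_continuous])
  show "C1 (\<lambda>x. u x * v x)"
    "grad (\<lambda>x. u x * v x) = (\<lambda>x. u x *\<^sub>R grad v x + v x *\<^sub>R grad u x)"
    using C1I[OF d c] by auto
qed

lemma
  assumes "C1 u"
  shows C1_cmult: "C1 (\<lambda>x. c * u x)"
    and grad_cmult: "grad (\<lambda>x. c * u x) = (\<lambda>x. c *\<^sub>R grad u x)"
  using C1_mult[OF C1_const[of c] assms] grad_mult[OF C1_const[of c] assms]
  by (simp_all add: grad_const)

lemma
  assumes "C1 u"
  shows C1_translate: "C1 (\<lambda>x. u (x + a))"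
    and grad_translate: "grad (\<lambda>x. u (x + a)) = (\<lambda>x. grad u (x + a))"
proof -
  have d: "((\<lambda>x. u (x + a)) has_derivative (\<lambda>h. grad u (x + a) \<bullet> h)) (at x)" for x
    by (rule has_derivative_compose[where f="\<lambda>x. x + a", OF _ C1_has_derivative[OF assms]])
       (auto intro!: derivative_eq_intros)
  have c: "continuous_on UNIV (\<lambda>x. grad u (x + a))"
    by (rule continuous_on_compose2[OF C1_continuous_grad[OF assms]]) (auto intro!: continuous_intros)
  show "C1 (\<lambda>x. u (x + a))" "grad (\<lambda>x. u (x + a)) = (\<lambda>x. grad u (x + a))"
    using C1I[OF d c] by auto
qed

lemma C1_compose:
  assumes "\<And>t. (f has_real_derivative f' t) (at t)" "continuous_on UNIV f'" "C1 u"
  shows "C1 (\<lambda>x. f (u x))"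
proof (rule C1I)
  show "((\<lambda>x. f (u x)) has_derivative (\<lambda>h. (f' (u x) *\<^sub>R grad u x) \<bullet> h)) (at x)" for x
    using has_derivative_compose[OF C1_has_derivative[OF assms(3)]
      assms(1)[of "u x", unfolded has_field_derivative_def]] by simp
  show "continuous_on UNIV (\<lambda>x. f' (u x) *\<^sub>R grad u x)"
    by (intro continuous_intros continuous_on_compose2[OF assms(2) C1_continuous[OF assms(3)]]
        C1_continuous_grad assms) auto
qed

lemma grad_eq_0_outside:
  assumes "closed K" "\<And>x. x \<notin> K \<Longrightarrow> u x = 0" "x \<notin> K"
  shows "grad u x = 0"
proof (rule grad_eqI)
  have "((\<lambda>x. 0) has_derivative (\<lambda>h. (0::real^2) \<bullet> h)) (at x)" by simp
  then show "(u has_derivative (\<lambda>h. 0 \<bullet> h)) (at x)"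
    by (rule has_derivative_transform_within_open[where s="- K"]) (use assms in auto)
qed

text \<open>
  The support may be replaced by any compact superset in \<open>\<Omega>\<close>, which spares closures
  in all constructions below.
\<close>
lemma C1c_iff:
  "u \<in> C1c \<Omega> \<longleftrightarrow> C1 u \<and> (\<exists>K. compact K \<and> K \<subseteq> \<Omega> \<and> (\<forall>x. x \<notin> K \<longrightarrow> u x = 0))"
proof
  assume "u \<in> C1c \<Omega>"
  then show "C1 u \<and> (\<exists>K. compact K \<and> K \<subseteq> \<Omega> \<and> (\<forall>x. x \<notin> K \<longrightarrow> u x = 0))"
    using closure_subset[of "{x. u x \<noteq> 0}"]
    by (auto simp: C1c_def C1_def intro!: exI[of _ "closure {x. u x \<noteq> 0}"])
next
  assume a: "C1 u \<and> (\<exists>K. compact K \<and> K \<subseteq> \<Omega> \<and> (\<forall>x. x \<notin> K \<longrightarrow> u x = 0))"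
  then obtain K where K: "compact K" "K \<subseteq> \<Omega>" "\<forall>x. x \<notin> K \<longrightarrow> u x = 0" by auto
  then have "closure {x. u x \<noteq> 0} \<subseteq> K"
    by (intro closure_minimal) (auto simp: compact_imp_closed)
  with a K show "u \<in> C1c \<Omega>"
    by (auto simp: C1c_def C1_def intro!: compact_closure[THEN iffD2] intro: bounded_subset compact_imp_bounded closure_subset)
qed

lemma C1cD: "u \<in> C1c \<Omega> \<Longrightarrow> C1 u"
  by (simp add: C1c_iff)

lemma C1c_supportE:
  assumes "u \<in> C1c \<Omega>"
  obtains K where "compact K" "K \<subseteq> \<Omega>" "\<And>x. x \<notin> K \<Longrightarrow> u x = 0" "\<And>x. x \<notin> K \<Longrightarrow> grad u x = 0"
  using assms grad_eq_0_outside unfolding C1c_iff by (metis compact_imp_closed)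

lemma
  assumes "u \<in> C1c \<Omega>" "x \<notin> \<Omega>"
  shows C1c_eq_0_outside: "u x = 0" and grad_C1c_eq_0_outside: "grad u x = 0"
proof -
  obtain K where "K \<subseteq> \<Omega>" "\<And>x. x \<notin> K \<Longrightarrow> u x = 0" "\<And>x. x \<notin> K \<Longrightarrow> grad u x = 0"
    using assms(1) by (rule C1c_supportE) blast
  then show "u x = 0" "grad u x = 0" using assms(2) by auto
qed

lemma C1c_subset_UNIV: "u \<in> C1c \<Omega> \<Longrightarrow> u \<in> C1c UNIV"
  by (auto simp: C1c_iff)

lemma C1c_zero: "(\<lambda>x. 0) \<in> C1c \<Omega>"
  using C1_const[of 0] by (auto simp: C1c_iff)

lemma C1c_add:
  assumes "u \<in> C1c \<Omega>" "v \<in> C1c \<Omega>"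
  shows "(\<lambda>x. u x + v x) \<in> C1c \<Omega>"
proof -
  obtain K where K: "compact K" "K \<subseteq> \<Omega>" "\<And>x. x \<notin> K \<Longrightarrow> u x = 0"
    using assms(1) by (rule C1c_supportE) blast
  obtain L where L: "compact L" "L \<subseteq> \<Omega>" "\<And>x. x \<notin> L \<Longrightarrow> v x = 0"
    using assms(2) by (rule C1c_supportE) blast
  have "compact (K \<union> L) \<and> K \<union> L \<subseteq> \<Omega> \<and> (\<forall>x. x \<notin> K \<union> L \<longrightarrow> u x + v x = 0)"
    using K L by (auto intro: compact_Un)
  then show ?thesis using C1_add[OF assms[THEN C1cD]] unfolding C1c_iff by blast
qed

lemma C1c_mult:
  assumes "C1 u" "v \<in> C1c \<Omega>"
  shows "(\<lambda>x. u x * v x) \<in> C1c \<Omega>"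
  using assms(2) C1_mult[OF assms(1) C1cD[OF assms(2)]] unfolding C1c_iff by auto

lemma C1c_sum:
  assumes "\<And>i. i < (n::nat) \<Longrightarrow> u i \<in> C1c \<Omega>"
  shows "(\<lambda>x. \<Sum>i<n. u i x) \<in> C1c \<Omega>"
  using assms by (induction n) (auto intro!: C1c_zero C1c_add)

lemma C1c_compose:
  assumes "\<And>t. (f has_real_derivative f' t) (at t)" "continuous_on UNIV f'" "f 0 = 0" "u \<in> C1c \<Omega>"
  shows "(\<lambda>x. f (u x)) \<in> C1c \<Omega>"
  using assms(3,4) C1_compose[OF assms(1,2) C1cD[OF assms(4)]] unfolding C1c_iff by auto

lemma C1c_translate:
  assumes "u \<in> C1c UNIV"
  shows "(\<lambda>x. u (x + a)) \<in> C1c UNIV"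
proof -
  obtain K where K: "compact K" "\<And>x. x \<notin> K \<Longrightarrow> u x = 0"
    using assms by (rule C1c_supportE) blast
  have "compact ((\<lambda>x. x - a) ` K)"
    by (intro compact_continuous_image continuous_intros K)
  moreover have "u (x + a) = 0" if "x \<notin> (\<lambda>x. x - a) ` K" for x
    using K(2)[of "x + a"] that by (force simp: image_iff)
  ultimately show ?thesis using C1_translate[OF C1cD[OF assms]] unfolding C1c_iff by blast
qed

section \<open>Integration by parts and the Poincare inequality\<close>

lemma integrable_compact_support:
  fixes f :: "'a::euclidean_space \<Rightarrow> real"
  assumes "continuous_on UNIV f" "compact K" "\<And>x. x \<notin> K \<Longrightarrow> f x = 0"
  shows "integrable lborel f"
proof -
  have "integrable lborel (\<lambda>x. indicator K x *\<^sub>R f x)"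
    using assms by (intro borel_integrable_compact) (auto intro: continuous_on_subset)
  moreover have "(\<lambda>x. indicator K x *\<^sub>R f x) = f" using assms(3) by (auto simp: fun_eq_iff indicator_def)
  ultimately show ?thesis by simp
qed

lemma integral_lebesgue_on_eq_lborel:
  fixes f :: "'a::euclidean_space \<Rightarrow> real"
  assumes "open \<Omega>" "continuous_on UNIV f" "\<And>x. x \<notin> \<Omega> \<Longrightarrow> f x = 0"
  shows "(\<integral>x. f x \<partial>lebesgue_on \<Omega>) = (\<integral>x. f x \<partial>lborel)"
proof -
  have "(\<integral>x. f x \<partial>lebesgue_on \<Omega>) = (\<integral>x. indicator \<Omega> x *\<^sub>R f x \<partial>lebesgue)"
    by (rule integral_restrict_space) (use assms in simp)
  also have "(\<lambda>x. indicator \<Omega> x *\<^sub>R f x) = f" using assms(3) by (auto simp: fun_eq_iff indicator_def)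
  also have "(\<integral>x. f x \<partial>lebesgue) = (\<integral>x. f x \<partial>lborel)"
    by (rule integral_completion) (use assms in \<open>auto intro: borel_measurable_continuous_onI\<close>)
  finally show ?thesis .
qed

lemma integral_lborel_translate:
  fixes f :: "'a::euclidean_space \<Rightarrow> real"
  assumes "f \<in> borel_measurable borel"
  shows "(\<integral>x. f (x + a) \<partial>lborel) = (\<integral>x. f x \<partial>lborel)"
proof -
  have "(\<integral>x. f x \<partial>lborel) = (\<integral>x. f x \<partial>distr lborel borel ((+) a))" by (simp add: lborel_distr_plus)
  also have "\<dots> = (\<integral>x. f (a + x) \<partial>lborel)" using assms by (intro integral_distr) auto
  finally show ?thesis by (simp add: add.commute)
qed

lemma C1c_grad_bounded:
  assumes "u \<in> C1c \<Omega>"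
  obtains B where "B > 0" "\<And>x. norm (grad u x) \<le> B"
proof -
  obtain K where K: "compact K" "\<And>x. x \<notin> K \<Longrightarrow> grad u x = 0"
    using assms by (rule C1c_supportE) blast
  have "bounded (grad u ` K)"
    by (intro compact_imp_bounded compact_continuous_image K
        continuous_on_subset[OF C1_continuous_grad[OF C1cD[OF assms]]]) simp
  then obtain B where B: "B > 0" "\<forall>y\<in>grad u ` K. norm y \<le> B" by (auto simp: bounded_pos)
  then have "norm (grad u x) \<le> B" for x by (cases "x \<in> K") (auto simp: K(2))
  with B(1) that show ?thesis by blast
qed

lemma C1c_Lipschitz:
  assumes "u \<in> C1c \<Omega>"
  obtains B where "B > 0" "\<And>x y. \<bar>u x - u y\<bar> \<le> B * norm (x - y)"
proof -
  obtain B where B: "B > 0" "\<And>x. norm (grad u x) \<le> B" using assms by (rule C1c_grad_bounded) blast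
  have "norm (u x - u y) \<le> B * norm (x - y)" for x y
  proof (rule differentiable_bound[where S=UNIV and f'="\<lambda>x h. grad u x \<bullet> h"])
    show "(u has_derivative (\<lambda>h. grad u z \<bullet> h)) (at z within UNIV)" for z
      using C1_has_derivative[OF C1cD[OF assms]] by simp
    show "onorm (\<lambda>h. grad u z \<bullet> h) \<le> B" for z
    proof (rule onorm_le)
      fix h
      have "norm (grad u z \<bullet> h) \<le> norm (grad u z) * norm h" by (simp add: Cauchy_Schwarz_ineq2)
      also have "\<dots> \<le> B * norm h" by (intro mult_right_mono B) simp
      finally show "norm (grad u z \<bullet> h) \<le> B * norm h" .
    qed
  qed auto
  with B(1) that show ?thesis by simp
qed

text \<open>
  Difference quotients along a sequence of increments, to which dominated convergence applies.
\<close>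
definition diff_quot :: "(real^2 \<Rightarrow> real) \<Rightarrow> real^2 \<Rightarrow> nat \<Rightarrow> real^2 \<Rightarrow> real" where
  "diff_quot u e n x = real (Suc n) * (u (x + (1 / real (Suc n)) *\<^sub>R e) - u x)"

lemma diff_quot_tendsto:
  assumes "C1 u"
  shows "(\<lambda>n. diff_quot u e n x) \<longlonglongrightarrow> grad u x \<bullet> e"
proof -
  have "((\<lambda>t. x + t *\<^sub>R e) has_derivative (\<lambda>t. t *\<^sub>R e)) (at 0)"
    by (auto intro!: derivative_eq_intros)
  then have "((\<lambda>t. u (x + t *\<^sub>R e)) has_derivative (\<lambda>t. grad u x \<bullet> (t *\<^sub>R e))) (at 0)"
    using has_derivative_compose[of "\<lambda>t. x + t *\<^sub>R e" "\<lambda>t. t *\<^sub>R e" 0 UNIV u "\<lambda>h. grad u x \<bullet> h"]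
      C1_has_derivative[OF assms, of x] by simp
  then have "((\<lambda>t. u (x + t *\<^sub>R e)) has_real_derivative (grad u x \<bullet> e)) (at 0)"
    by (rule has_derivative_imp_has_field_derivative) simp
  then have lim: "(\<lambda>t. (u (x + t *\<^sub>R e) - u x) / t) \<midarrow>0\<rightarrow> grad u x \<bullet> e"
    by (simp add: has_field_derivative_iff)
  have "filterlim (\<lambda>n. inverse (real (Suc n))) (at 0) sequentially"
    using LIMSEQ_inverse_real_of_nat by (simp add: filterlim_at)
  from filterlim_compose[OF lim this] have "(\<lambda>n. (u (x + inverse (real (Suc n)) *\<^sub>R e) - u x) / inverse (real (Suc n))) \<longlonglongrightarrow> grad u x \<bullet> e"
    .
  then show ?thesis by (simp add: diff_quot_def field_simps)
qed

text \<open>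
  Dominated convergence: the difference quotients are bounded by the Lipschitz constant and vanish
  outside a ball that is independent of \<open>n\<close>.
\<close>
lemma integral_diff_quot_tendsto:
  assumes u: "u \<in> C1c UNIV" and w: "continuous_on UNIV w"
  shows "(\<lambda>n. \<integral>x. w x * diff_quot u e n x \<partial>lborel) \<longlonglongrightarrow> (\<integral>x. w x * (grad u x \<bullet> e) \<partial>lborel)"
proof -
  obtain K where K: "compact K" "\<And>x. x \<notin> K \<Longrightarrow> u x = 0" using u by (rule C1c_supportE) blast
  obtain R where R: "\<And>x. x \<in> K \<Longrightarrow> norm x \<le> R"
    using compact_imp_bounded[OF K(1)] by (auto simp: bounded_iff)
  obtain B where B: "B > 0" "\<And>x y. \<bar>u x - u y\<bar> \<le> B * norm (x - y)" using u by (rule C1c_Lipschitz) blast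
  let ?Q = "cball (0::real^2) (R + norm e)"
  have cu: "continuous_on UNIV u" "continuous_on UNIV (grad u)"
    using C1cD[OF u] by (auto intro: C1_continuous C1_continuous_grad)
  have cq: "continuous_on UNIV (diff_quot u e n)" for n
    unfolding diff_quot_def by (intro continuous_intros continuous_on_compose2[OF cu(1)]) auto
  have small: "norm ((1 / real (Suc n)) *\<^sub>R e) \<le> norm e" for n
    using mult_right_mono[of "1 / real (Suc n)" 1 "norm e"] by simp
  have zero: "diff_quot u e n x = 0" if "x \<notin> ?Q" for n x
  proof -
    have "x \<notin> K"
    proof
      assume "x \<in> K"
      from R[OF this] have "norm x \<le> R + norm e" using norm_ge_zero[of e] by linarith
      with that show False by simp
    qed
    moreover have "x + (1 / real (Suc n)) *\<^sub>R e \<notin> K"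
    proof
      assume "x + (1 / real (Suc n)) *\<^sub>R e \<in> K"
      from R[OF this] have "norm x \<le> R + norm e"
        using norm_diff_ineq[of x "(1 / real (Suc n)) *\<^sub>R e"] small[of n] by linarith
      with that show False by simp
    qed
    ultimately show ?thesis by (simp add: diff_quot_def K(2))
  qed
  have bound: "\<bar>diff_quot u e n x\<bar> \<le> B * norm e" for n x
  proof -
    have "\<bar>diff_quot u e n x\<bar> = real (Suc n) * \<bar>u (x + (1 / real (Suc n)) *\<^sub>R e) - u x\<bar>"
      unfolding diff_quot_def abs_mult by simp
    also have "\<dots> \<le> real (Suc n) * (B * norm ((x + (1 / real (Suc n)) *\<^sub>R e) - x))"
      by (intro mult_left_mono B) simp
    also have "\<dots> = B * norm e" by simp
    finally show ?thesis .
  qed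
  show ?thesis
  proof (rule integral_dominated_convergence)
    show "(\<lambda>x. w x * (grad u x \<bullet> e)) \<in> borel_measurable lborel"
      using w cu by (auto intro!: borel_measurable_continuous_onI continuous_intros)
    show "(\<lambda>x. w x * diff_quot u e n x) \<in> borel_measurable lborel" for n
      using w cq by (auto intro!: borel_measurable_continuous_onI continuous_intros)
    show "integrable lborel (\<lambda>x. indicator ?Q x *\<^sub>R (\<bar>w x\<bar> * (B * norm e)))"
      by (intro borel_integrable_compact continuous_intros continuous_on_subset[OF w]) auto
    show "AE x in lborel. (\<lambda>n. w x * diff_quot u e n x) \<longlonglongrightarrow> w x * (grad u x \<bullet> e)"
      using diff_quot_tendsto[OF C1cD[OF u]] by (auto intro!: tendsto_intros)
    show "AE x in lborel. norm (w x * diff_quot u e n x) \<le> indicator ?Q x *\<^sub>R (\<bar>w x\<bar> * (B * norm e))" for n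
    proof (rule AE_I2)
      fix x
      show "norm (w x * diff_quot u e n x) \<le> indicator ?Q x *\<^sub>R (\<bar>w x\<bar> * (B * norm e))"
        using zero[of x n] bound[of n x]
        by (cases "x \<in> ?Q") (auto simp: abs_mult intro!: mult_left_mono)
    qed
  qed
qed

lemma integrable_C1c:
  assumes "u \<in> C1c \<Omega>" "continuous_on UNIV w"
  shows "integrable lborel (\<lambda>x. w x * u x)" "integrable lborel (\<lambda>x. w x * (grad u x \<bullet> e))"
proof -
  obtain K where K: "compact K" "\<And>x. x \<notin> K \<Longrightarrow> u x = 0" "\<And>x. x \<notin> K \<Longrightarrow> grad u x = 0"
    using assms(1) by (rule C1c_supportE) blast
  have c: "continuous_on UNIV u" "continuous_on UNIV (grad u)"
    using C1cD[OF assms(1)] by (auto intro: C1_continuous C1_continuous_grad)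
  show "integrable lborel (\<lambda>x. w x * u x)" "integrable lborel (\<lambda>x. w x * (grad u x \<bullet> e))"
    by (rule integrable_compact_support[OF _ K(1)]; use K c assms(2) in \<open>auto intro!: continuous_intros\<close>)+
qed

text \<open>
  The integral is translation invariant, so each difference quotient already has integral zero.
\<close>
lemma integral_grad_C1c:
  assumes "u \<in> C1c UNIV"
  shows "(\<integral>x. grad u x \<bullet> e \<partial>lborel) = 0"
proof -
  have "(\<integral>x. diff_quot u e n x \<partial>lborel) = 0" for n
  proof -
    have "integrable lborel u" "integrable lborel (\<lambda>x. u (x + (1 / real (Suc n)) *\<^sub>R e))"
      using integrable_C1c(1)[OF assms continuous_on_const[of _ 1]]
        integrable_C1c(1)[OF C1c_translate[OF assms] continuous_on_const[of _ 1]] by simp_all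
    moreover have "(\<integral>x. u (x + (1 / real (Suc n)) *\<^sub>R e) \<partial>lborel) = (\<integral>x. u x \<partial>lborel)"
      by (intro integral_lborel_translate borel_measurable_continuous_onI C1_continuous C1cD[OF assms])
    ultimately show ?thesis unfolding diff_quot_def by simp
  qed
  then show ?thesis
    using integral_diff_quot_tendsto[OF assms continuous_on_const[of _ 1], of e]
    by (simp add: LIMSEQ_const_iff)
qed

lemma integral_by_parts:
  assumes "C1 u" "v \<in> C1c UNIV"
  shows "(\<integral>x. u x * (grad v x \<bullet> e) \<partial>lborel) = - (\<integral>x. (grad u x \<bullet> e) * v x \<partial>lborel)"
proof -
  have "(\<integral>x. u x * (grad v x \<bullet> e) + (grad u x \<bullet> e) * v x \<partial>lborel)
      = (\<integral>x. grad (\<lambda>x. u x * v x) x \<bullet> e \<partial>lborel)"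
    by (simp add: grad_mult[OF assms(1) C1cD[OF assms(2)]] inner_add_left mult.commute)
  also have "\<dots> = 0" by (rule integral_grad_C1c[OF C1c_mult[OF assms]])
  finally have "(\<integral>x. u x * (grad v x \<bullet> e) + (grad u x \<bullet> e) * v x \<partial>lborel) = 0" .
  moreover have "integrable lborel (\<lambda>x. u x * (grad v x \<bullet> e))"
    by (rule integrable_C1c(2)[OF assms(2) C1_continuous[OF assms(1)]])
  moreover have "integrable lborel (\<lambda>x. (grad u x \<bullet> e) * v x)"
    by (rule integrable_C1c(1)[OF assms(2)]) (intro continuous_intros C1_continuous_grad assms)
  ultimately show ?thesis by simp
qed

text \<open>
  For \<open>C2\<close> functions this is two integrations by parts together with the symmetry of the second
  derivatives. For \<open>C1\<close> functions one of the two derivatives is replaced by a difference quotient: a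
  difference quotient of \<open>v\<close> in direction \<open>b\<close> becomes, after an integration by parts in direction \<open>a\<close> and a
  translation, a difference quotient of \<open>u\<close> in direction \<open>- b\<close>.
\<close>
lemma integral_grad_grad_commute:
  assumes u: "u \<in> C1c UNIV" and v: "v \<in> C1c UNIV"
  shows "(\<integral>x. (grad u x \<bullet> a) * (grad v x \<bullet> b) \<partial>lborel) = (\<integral>x. (grad u x \<bullet> b) * (grad v x \<bullet> a) \<partial>lborel)"
proof -
  have cu: "continuous_on UNIV u" "continuous_on UNIV (grad u)"
    using C1cD[OF u] by (auto intro: C1_continuous C1_continuous_grad)
  have cv: "continuous_on UNIV v" "continuous_on UNIV (grad v)"
    using C1cD[OF v] by (auto intro: C1_continuous C1_continuous_grad)
  have swap: "(\<integral>x. (grad u x \<bullet> a) * diff_quot v b n x \<partial>lborel)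
      = - (\<integral>x. (grad v x \<bullet> a) * diff_quot u (- b) n x \<partial>lborel)" for n
  proof -
    define t where "t = (1 / real (Suc n)) *\<^sub>R b"
    have dv: "C1 (diff_quot v b n)"
      and gv: "grad (diff_quot v b n) = (\<lambda>x. real (Suc n) *\<^sub>R (grad v (x + t) - grad v x))"
    proof -
      have e: "diff_quot v b n = (\<lambda>x. real (Suc n) * (v (x + t) + (-1) * v x))"
        by (auto simp: diff_quot_def t_def)
      note c = C1_translate[OF C1cD[OF v], of t] C1_cmult[OF C1cD[OF v], of "-1"]
      show "C1 (diff_quot v b n)" unfolding e by (intro C1_cmult C1_add c)
      show "grad (diff_quot v b n) = (\<lambda>x. real (Suc n) *\<^sub>R (grad v (x + t) - grad v x))"
        unfolding e grad_cmult[OF C1_add[OF c]] grad_add[OF c]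
          grad_translate[OF C1cD[OF v]] grad_cmult[OF C1cD[OF v]] by simp
    qed
    have i: "integrable lborel (\<lambda>x. (grad v (x + t) \<bullet> a) * u x)"
      "integrable lborel (\<lambda>x. (grad v x \<bullet> a) * u x)"
      "integrable lborel (\<lambda>x. (grad v x \<bullet> a) * u (x - t))"
    proof -
      have c: "continuous_on UNIV (\<lambda>x. grad v (x + t) \<bullet> a)" "continuous_on UNIV (\<lambda>x. grad v x \<bullet> a)"
        by (auto intro!: continuous_intros cv continuous_on_compose2[OF cv(2)])
      show "integrable lborel (\<lambda>x. (grad v (x + t) \<bullet> a) * u x)"
        "integrable lborel (\<lambda>x. (grad v x \<bullet> a) * u x)"
        "integrable lborel (\<lambda>x. (grad v x \<bullet> a) * u (x - t))"
        using integrable_C1c(1)[OF u c(1)] integrable_C1c(1)[OF u c(2)]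
          integrable_C1c(1)[OF C1c_translate[OF u, of "- t"] c(2)] by simp_all
    qed
    have shift: "(\<integral>x. (grad v (x + t) \<bullet> a) * u x \<partial>lborel) = (\<integral>x. (grad v x \<bullet> a) * u (x - t) \<partial>lborel)"
      using integral_lborel_translate[of "\<lambda>x. (grad v x \<bullet> a) * u (x - t)" t]
      by (simp add: borel_measurable_continuous_onI continuous_intros cv continuous_on_compose2[OF cu(1)])
    have "(\<integral>x. (grad u x \<bullet> a) * diff_quot v b n x \<partial>lborel)
        = (\<integral>x. diff_quot v b n x * (grad u x \<bullet> a) \<partial>lborel)" by (simp add: mult.commute)
    also have "\<dots> = - (\<integral>x. (grad (diff_quot v b n) x \<bullet> a) * u x \<partial>lborel)"
      by (rule integral_by_parts[OF dv u])
    also have "(\<integral>x. (grad (diff_quot v b n) x \<bullet> a) * u x \<partial>lborel)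
        = (\<integral>x. real (Suc n) * ((grad v (x + t) \<bullet> a) * u x - (grad v x \<bullet> a) * u x) \<partial>lborel)"
      unfolding gv by (simp add: inner_diff_left algebra_simps)
    also have "\<dots> = real (Suc n) * ((\<integral>x. (grad v x \<bullet> a) * u (x - t) \<partial>lborel) - (\<integral>x. (grad v x \<bullet> a) * u x \<partial>lborel))"
      using i shift by simp
    also have "\<dots> = (\<integral>x. real (Suc n) * ((grad v x \<bullet> a) * u (x - t) - (grad v x \<bullet> a) * u x) \<partial>lborel)"
      using i by simp
    also have "\<dots> = (\<integral>x. (grad v x \<bullet> a) * diff_quot u (- b) n x \<partial>lborel)"
      by (simp add: diff_quot_def t_def algebra_simps)
    finally show ?thesis .
  qed
  have "(\<lambda>n. \<integral>x. (grad u x \<bullet> a) * diff_quot v b n x \<partial>lborel) \<longlonglongrightarrow> (\<integral>x. (grad u x \<bullet> a) * (grad v x \<bullet> b) \<partial>lborel)"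
    by (rule integral_diff_quot_tendsto[OF v]) (intro continuous_intros cu)
  moreover have "(\<lambda>n. - (\<integral>x. (grad v x \<bullet> a) * diff_quot u (- b) n x \<partial>lborel))
      \<longlonglongrightarrow> - (\<integral>x. (grad v x \<bullet> a) * (grad u x \<bullet> (- b)) \<partial>lborel)"
    by (intro tendsto_minus integral_diff_quot_tendsto[OF u]) (intro continuous_intros cv)
  ultimately have "(\<integral>x. (grad u x \<bullet> a) * (grad v x \<bullet> b) \<partial>lborel)
      = - (\<integral>x. (grad v x \<bullet> a) * (grad u x \<bullet> (- b)) \<partial>lborel)"
    unfolding swap by (rule LIMSEQ_unique)
  then show ?thesis by (simp add: mult.commute)
qed

text \<open>
  Integrating \<open>u^2 = D_1 x_1 * u^2\<close> by parts gives the integral of \<open>- 2 x_1 u D_1 u\<close>. Since \<open>x_1\<close> is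
  bounded on \<open>\<Omega>\<close>, this is at most half of the integral of \<open>u^2\<close>, which the left side absorbs, plus a multiple
  of the integral of \<open>|grad u|^2\<close>.
\<close>
lemma Poincare_inequality:
  assumes "bounded \<Omega>"
  obtains C where "C \<ge> 0"
    "\<And>u. u \<in> C1c \<Omega> \<Longrightarrow> (\<integral>x. (u x)\<^sup>2 \<partial>lborel) \<le> C * (\<integral>x. (norm (grad u x))\<^sup>2 \<partial>lborel)"
proof -
  obtain R where R: "\<And>x. x \<in> \<Omega> \<Longrightarrow> norm x \<le> R" using assms by (auto simp: bounded_iff)
  have "(\<integral>x. (u x)\<^sup>2 \<partial>lborel) \<le> 4 * R\<^sup>2 * (\<integral>x. (norm (grad u x))\<^sup>2 \<partial>lborel)" if u: "u \<in> C1c \<Omega>" for u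
  proof -
    define e where "e = axis (1::2) (1::real)"
    obtain K where K: "compact K" "K \<subseteq> \<Omega>" "\<And>x. x \<notin> K \<Longrightarrow> u x = 0" "\<And>x. x \<notin> K \<Longrightarrow> grad u x = 0"
      using u by (rule C1c_supportE) blast
    have c: "continuous_on UNIV u" "continuous_on UNIV (grad u)"
      using C1cD[OF u] by (auto intro: C1_continuous C1_continuous_grad)
    have c1: "continuous_on UNIV (\<lambda>x::real^2. x $ 1)" by (intro continuous_intros)
    have guu: "grad (\<lambda>x. u x * u x) x \<bullet> e = 2 * u x * (grad u x \<bullet> e)" for x
      unfolding grad_mult[OF C1cD[OF u] C1cD[OF u]] inner_add_left inner_scaleR_left by simp
    have uu: "(\<lambda>x. u x * u x) \<in> C1c UNIV" by (rule C1c_mult[OF C1cD[OF u] C1c_subset_UNIV[OF u]])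
    have i1: "integrable lborel (\<lambda>x. (u x)\<^sup>2)"
      by (rule integrable_compact_support[OF _ K(1)]) (use K c in \<open>auto intro!: continuous_intros\<close>)
    have i2: "integrable lborel (\<lambda>x. (norm (grad u x))\<^sup>2)"
      by (rule integrable_compact_support[OF _ K(1)]) (use K c in \<open>auto intro!: continuous_intros\<close>)
    have i3: "integrable lborel (\<lambda>x. x $ 1 * (2 * u x * (grad u x \<bullet> e)))"
      by (rule integrable_compact_support[OF _ K(1)]) (use K c c1 in \<open>auto intro!: continuous_intros\<close>)
    have "(\<integral>x. (u x)\<^sup>2 \<partial>lborel) = (\<integral>x. (grad (\<lambda>x. x $ 1) x \<bullet> e) * (u x * u x) \<partial>lborel)"
      by (simp add: grad_nth e_def inner_axis_axis power2_eq_square)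
    also have "\<dots> = - (\<integral>x. x $ 1 * (grad (\<lambda>x. u x * u x) x \<bullet> e) \<partial>lborel)"
      using integral_by_parts[OF C1_nth uu] by simp
    also have "\<dots> = (\<integral>x. - (x $ 1 * (2 * u x * (grad u x \<bullet> e))) \<partial>lborel)"
      by (simp add: guu)
    also have "\<dots> \<le> (\<integral>x. (u x)\<^sup>2 / 2 + 2 * R\<^sup>2 * (norm (grad u x))\<^sup>2 \<partial>lborel)"
    proof (rule integral_mono)
      show "integrable lborel (\<lambda>x. - (x $ 1 * (2 * u x * (grad u x \<bullet> e))))" using i3 by simp
      show "integrable lborel (\<lambda>x. (u x)\<^sup>2 / 2 + 2 * R\<^sup>2 * (norm (grad u x))\<^sup>2)" using i1 i2 by simp
      fix x
      show "- (x $ 1 * (2 * u x * (grad u x \<bullet> e))) \<le> (u x)\<^sup>2 / 2 + 2 * R\<^sup>2 * (norm (grad u x))\<^sup>2"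
      proof (cases "x \<in> K")
        case True
        define d where "d = x $ 1 * (grad u x \<bullet> e)"
        have "\<bar>x $ 1\<bar> \<le> R" using R[of x] True K(2) component_le_norm_cart[of x 1] by auto
        moreover have "\<bar>grad u x \<bullet> e\<bar> \<le> norm (grad u x)"
          using Cauchy_Schwarz_ineq2[of "grad u x" e] by (simp add: e_def)
        ultimately have "\<bar>d\<bar> \<le> R * norm (grad u x)"
          unfolding d_def abs_mult by (intro mult_mono) auto
        then have "d\<^sup>2 \<le> (R * norm (grad u x))\<^sup>2" by (rule abs_le_square_iff[THEN iffD1, OF order_trans]) simp
        moreover have "0 \<le> (u x + 2 * d)\<^sup>2" by simp
        ultimately show ?thesis
          by (simp add: d_def power2_eq_square algebra_simps)
      qed (simp add: K)
    qed
    also have "\<dots> = (\<integral>x. (u x)\<^sup>2 \<partial>lborel) / 2 + 2 * R\<^sup>2 * (\<integral>x. (norm (grad u x))\<^sup>2 \<partial>lborel)"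
      using i1 i2 by simp
    finally show ?thesis by simp
  qed
  then show ?thesis using that[of "4 * R\<^sup>2"] by simp
qed

section \<open>The fundamental lemma of the calculus of variations\<close>

lemma C1_positive_part_square:
  assumes "C1 u"
  shows "C1 (\<lambda>x. (max 0 (u x))\<^sup>2)"
proof (rule C1_compose[OF _ _ assms])
  show "continuous_on UNIV (\<lambda>t::real. 2 * max 0 t)" by (intro continuous_intros)
  show "((\<lambda>t. (max 0 t)\<^sup>2) has_real_derivative 2 * max 0 t) (at t)" for t :: real
  proof -
    consider "t < 0" | "t = 0" | "t > 0" by linarith
    then show ?thesis
    proof cases
      case 1
      have "((\<lambda>t. 0) has_real_derivative 2 * max 0 t) (at t)" using 1 by simp
      then show ?thesis
        by (rule has_field_derivative_transform_within_open[where S="{..<0}"]) (use 1 in auto)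
    next
      case 2
      have "(\<lambda>h. (max 0 h)\<^sup>2 / h) \<midarrow>0\<rightarrow> (0::real)"
      proof (rule tendsto_rabs_zero_cancel, rule tendsto_sandwich[OF _ _ tendsto_const])
        show "\<forall>\<^sub>F h in at (0::real). \<bar>(max 0 h)\<^sup>2 / h\<bar> \<le> \<bar>h\<bar>"
          by (intro always_eventually allI) (auto simp: max_def power2_eq_square abs_mult)
        show "(\<lambda>h::real. \<bar>h\<bar>) \<midarrow>0\<rightarrow> 0" by (intro tendsto_eq_intros) auto
      qed simp
      then show ?thesis using 2 by (simp add: has_field_derivative_iff)
    next
      case 3
      have "((\<lambda>t. t\<^sup>2) has_real_derivative 2 * max 0 t) (at t)"
        using 3 by (auto intro!: derivative_eq_intros)
      then show ?thesis
        by (rule has_field_derivative_transform_within_open[where S="{0<..}"]) (use 3 in auto)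
    qed
  qed
qed

text \<open>
  The bump is the square of the positive part of \<open>r^2 - |x - c|^2\<close>; squaring removes the kink on the
  sphere.
\<close>
lemma C1c_ball_bump:
  fixes c :: "real^2"
  assumes "r > 0" "cball c r \<subseteq> \<Omega>"
  obtains \<rho> where "\<rho> \<in> C1c \<Omega>" "\<And>x. \<rho> x \<ge> 0" "\<And>x. \<rho> x > 0 \<longleftrightarrow> x \<in> ball c r"
proof -
  define \<rho> where "\<rho> x = (max 0 (r\<^sup>2 - (x - c) \<bullet> (x - c)))\<^sup>2" for x
  have pos: "max 0 (r\<^sup>2 - (x - c) \<bullet> (x - c)) > 0 \<longleftrightarrow> x \<in> ball c r" for x
  proof -
    have "(x - c) \<bullet> (x - c) = (dist c x)\<^sup>2"
      unfolding dist_norm norm_minus_commute[of c x] by (simp add: power2_norm_eq_inner)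
    then show ?thesis
      using assms(1) power_mono_iff[of r "dist c x" 2] by (auto simp: not_le[symmetric])
  qed
  have "C1 (\<lambda>x. r\<^sup>2 - (x - c) \<bullet> (x - c))"
  proof (rule C1I)
    show "((\<lambda>x. r\<^sup>2 - (x - c) \<bullet> (x - c)) has_derivative (\<lambda>h. (- 2 *\<^sub>R (x - c)) \<bullet> h)) (at x)" for x
      by (auto intro!: derivative_eq_intros simp: inner_commute)
  qed (intro continuous_intros)
  then have "C1 \<rho>"
    unfolding \<rho>_def by (rule C1_positive_part_square)
  moreover have "\<rho> x = 0" if "x \<notin> cball c r" for x
    using pos[of x] that by (auto simp: \<rho>_def max_def split: if_splits)
  ultimately have "\<rho> \<in> C1c \<Omega>" using assms(2) unfolding C1c_iff by (meson compact_cball)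
  moreover have "\<rho> x \<ge> 0" for x by (simp add: \<rho>_def)
  moreover have "\<rho> x > 0 \<longleftrightarrow> x \<in> ball c r" for x
  proof -
    have "0 < m\<^sup>2 \<longleftrightarrow> 0 < m" if "0 \<le> m" for m :: real using that by auto
    then show ?thesis unfolding pos[of x, symmetric] by (simp add: \<rho>_def)
  qed
  ultimately show ?thesis using that by blast
qed

text \<open>
  Cover \<open>U\<close> by countably many balls and let \<open>s n\<close> be the sum of the first \<open>n\<close> bumps. Then
  \<open>n * s n x\<close> tends to infinity for \<open>x\<close> in \<open>U\<close> and is zero elsewhere, so \<open>1 - exp (- (n * s n x))\<close>
  converges to the indicator while staying between 0 and 1.
\<close>
lemma C1c_approximates_indicator:
  assumes "open U" "U \<subseteq> \<Omega>"
  obtains \<zeta> where "\<And>n. \<zeta> n \<in> C1c \<Omega>" "\<And>n x. 0 \<le> \<zeta> n x \<and> \<zeta> n x \<le> 1"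
    "\<And>x. (\<lambda>n::nat. \<zeta> n x) \<longlonglongrightarrow> indicator U x"
proof -
  define \<B> where "\<B> = {ball c r |c r. r > 0 \<and> cball c r \<subseteq> U}"
  obtain \<B>' where B': "\<B>' \<subseteq> \<B>" "countable \<B>'" "\<Union>\<B>' = \<Union>\<B>"
    using Lindelof[of \<B>] by (auto simp: \<B>_def)
  have U: "\<Union>\<B>' = U"
  proof -
    have "x \<in> \<Union>\<B>" if "x \<in> U" for x
      using open_contains_cball[THEN iffD1, OF assms(1), rule_format, OF that]
      by (auto simp: \<B>_def intro!: exI[of _ x])
    moreover have "\<Union>\<B> \<subseteq> U" using ball_subset_cball by (fastforce simp: \<B>_def)
    ultimately show ?thesis using B' by auto
  qed
  have "\<exists>\<rho>. \<rho> \<in> C1c \<Omega> \<and> (\<forall>x. \<rho> x \<ge> 0) \<and> (\<forall>x. \<rho> x > 0 \<longleftrightarrow> x \<in> S)" if S: "S \<in> \<B>'" for S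
  proof -
    obtain c r where b: "S = ball c r" "r > 0" "cball c r \<subseteq> U" using S B'(1) unfolding \<B>_def by blast
    then have "cball c r \<subseteq> \<Omega>" using assms(2) by blast
    then obtain \<rho> where "\<rho> \<in> C1c \<Omega>" "\<And>x. \<rho> x \<ge> 0" "\<And>x. \<rho> x > 0 \<longleftrightarrow> x \<in> ball c r"
      using C1c_ball_bump[OF b(2)] by blast
    with b(1) show ?thesis by blast
  qed
  then obtain \<rho> where \<rho>: "\<And>S. S \<in> \<B>' \<Longrightarrow> \<rho> S \<in> C1c \<Omega>" "\<And>S x. S \<in> \<B>' \<Longrightarrow> \<rho> S x \<ge> 0"
      "\<And>S x. S \<in> \<B>' \<Longrightarrow> \<rho> S x > 0 \<longleftrightarrow> x \<in> S"
    by metis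
  show ?thesis
  proof (cases "\<B>' = {}")
    case True
    then show ?thesis using U by (intro that[of "\<lambda>n x. 0"]) (auto intro: C1c_zero)
  next
    case False
    define S where "S i = from_nat_into \<B>' i" for i
    have S: "S i \<in> \<B>'" for i unfolding S_def by (rule from_nat_into[OF False])
    define s where "s n x = (\<Sum>i<n. \<rho> (S i) x)" for n x
    have s0: "s n x \<ge> 0" for n x unfolding s_def by (intro sum_nonneg \<rho> S)
    define \<zeta> where "\<zeta> n x = 1 - exp (- (real n * s n x))" for n x
    show ?thesis
    proof (rule that[of \<zeta>])
      show "\<zeta> n \<in> C1c \<Omega>" for n
        unfolding \<zeta>_def s_def
        by (rule C1c_compose[where f="\<lambda>t. 1 - exp (- (real n * t))" and f'="\<lambda>t. real n * exp (- (real n * t))"])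
           (auto intro!: derivative_eq_intros continuous_intros C1c_sum \<rho> S)
      show "0 \<le> \<zeta> n x \<and> \<zeta> n x \<le> 1" for n x using s0[of n x] by (simp add: \<zeta>_def)
      show "(\<lambda>n. \<zeta> n x) \<longlonglongrightarrow> indicator U x" for x
      proof (cases "x \<in> U")
        case False
        then have "\<rho> (S i) x = 0" for i using \<rho>(2,3)[OF S[of i], of x] U S[of i] by fastforce
        then show ?thesis using False by (simp add: \<zeta>_def s_def)
      next
        case True
        then obtain T where "T \<in> \<B>'" "x \<in> T" using U by auto
        then obtain k where k: "x \<in> S k"
          unfolding S_def by (metis from_nat_into_surj[OF B'(2)])
        define p where "p = \<rho> (S k) x"
        have p: "p > 0" using k \<rho>(3)[OF S] by (simp add: p_def)
        have low: "p \<le> s n x" if "n > k" for n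
          unfolding s_def p_def using that by (intro member_le_sum) (auto intro: \<rho> S)
        have "(\<lambda>n. exp (- (real n * p))) = (\<lambda>n. exp (- p) ^ n)"
          by (simp add: exp_of_nat_mult[symmetric] algebra_simps)
        then have lim: "(\<lambda>n. exp (- (real n * p))) \<longlonglongrightarrow> 0"
          using p by (simp add: LIMSEQ_realpow_zero)
        have "(\<lambda>n. exp (- (real n * s n x))) \<longlonglongrightarrow> 0"
        proof (rule tendsto_sandwich[OF _ _ tendsto_const lim])
          show "\<forall>\<^sub>F n in sequentially. exp (- (real n * s n x)) \<le> exp (- (real n * p))"
            using eventually_gt_at_top[of k] by eventually_elim (auto intro!: mult_left_mono low)
        qed simp
        then have "(\<lambda>n. \<zeta> n x) \<longlonglongrightarrow> 1 - 0" unfolding \<zeta>_def by (intro tendsto_intros)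
        then show ?thesis using True by simp
      qed
    qed
  qed
qed

lemma sets_lebesgue_on_open: "open U \<Longrightarrow> U \<subseteq> \<Omega> \<Longrightarrow> open \<Omega> \<Longrightarrow> U \<in> sets (lebesgue_on \<Omega>)"
  by (auto simp: sets_restrict_space_iff)

lemma borel_measurable_lebesgue_on:
  fixes f :: "'a::euclidean_space \<Rightarrow> 'b::euclidean_space"
  assumes "f \<in> borel_measurable borel"
  shows "f \<in> borel_measurable (lebesgue_on \<Omega>)"
  by (intro measurable_restrict_space1 measurable_completion) (use assms in simp)

lemma integral_open_eq_0_of_orthogonal_C1c:
  fixes f :: "real^2 \<Rightarrow> real"
  assumes "open \<Omega>" "integrable (lebesgue_on \<Omega>) f"
    and orth: "\<And>\<eta>. \<eta> \<in> C1c \<Omega> \<Longrightarrow> (\<integral>x. f x * \<eta> x \<partial>lebesgue_on \<Omega>) = 0"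
    and U: "open U" "U \<subseteq> \<Omega>"
  shows "(\<integral>x. f x * indicator U x \<partial>lebesgue_on \<Omega>) = 0"
proof -
  obtain \<zeta> where \<zeta>: "\<And>n. \<zeta> n \<in> C1c \<Omega>" "\<And>n x. 0 \<le> \<zeta> n x \<and> \<zeta> n x \<le> 1"
    "\<And>x. (\<lambda>n::nat. \<zeta> n x) \<longlonglongrightarrow> indicator U x"
    using C1c_approximates_indicator[OF U] by blast
  have [measurable]: "f \<in> borel_measurable (lebesgue_on \<Omega>)" using assms(2) by simp
  have [measurable]: "U \<in> sets (lebesgue_on \<Omega>)" by (rule sets_lebesgue_on_open[OF U assms(1)])
  have [measurable]: "\<zeta> n \<in> borel_measurable (lebesgue_on \<Omega>)" for n
    by (intro borel_measurable_lebesgue_on borel_measurable_continuous_onI C1_continuous C1cD[OF \<zeta>(1)])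
  have "(\<lambda>n. \<integral>x. f x * \<zeta> n x \<partial>lebesgue_on \<Omega>) \<longlonglongrightarrow> (\<integral>x. f x * indicator U x \<partial>lebesgue_on \<Omega>)"
  proof (rule integral_dominated_convergence)
    show "integrable (lebesgue_on \<Omega>) (\<lambda>x. \<bar>f x\<bar>)" using assms(2) by simp
    show "AE x in lebesgue_on \<Omega>. (\<lambda>n. f x * \<zeta> n x) \<longlonglongrightarrow> f x * indicator U x"
      using \<zeta>(3) by (auto intro!: tendsto_intros)
    show "AE x in lebesgue_on \<Omega>. norm (f x * \<zeta> n x) \<le> \<bar>f x\<bar>" for n
      using \<zeta>(2) by (auto simp: abs_mult intro!: mult_left_le)
  qed measurable
  then show ?thesis using orth[OF \<zeta>(1)] by (simp add: LIMSEQ_const_iff)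
qed

text \<open>
  The integral of \<open>f\<close> over open, hence over relatively closed subsets of \<open>\<Omega>\<close> vanishes. A closed
  subset of the set where \<open>f\<close> is positive is therefore null, and such subsets exhaust that set up to small measure.
\<close>
lemma AE_nonpos_of_orthogonal_C1c:
  fixes f :: "real^2 \<Rightarrow> real"
  assumes \<Omega>: "open \<Omega>" and f: "integrable (lebesgue_on \<Omega>) f"
    and orth: "\<And>\<eta>. \<eta> \<in> C1c \<Omega> \<Longrightarrow> (\<integral>x. f x * \<eta> x \<partial>lebesgue_on \<Omega>) = 0"
  shows "AE x in lebesgue_on \<Omega>. f x \<le> 0"
proof -
  let ?M = "lebesgue_on \<Omega>"
  have fm[measurable]: "f \<in> borel_measurable ?M" using f by simp
  define E where "E = {x \<in> space ?M. 0 < f x}"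
  have E: "E \<in> sets ?M" unfolding E_def by measurable
  then have E': "E \<in> sets lebesgue" "E \<subseteq> \<Omega>"
    using \<Omega> by (auto simp: sets_restrict_space_iff)
  have small: "emeasure lebesgue E \<le> ennreal e" if e: "e > 0" for e
  proof -
    obtain T where T: "closed T" "T \<subseteq> E" "E - T \<in> lmeasurable" "emeasure lebesgue (E - T) < ennreal e"
      using sets_lebesgue_inner_closed[OF E'(1) e] by blast
    have TM: "T \<in> sets ?M" "\<Omega> - T \<in> sets ?M" "\<Omega> \<in> sets ?M"
      using T E' \<Omega> by (auto simp: sets_restrict_space_iff)
    have i: "integrable ?M (\<lambda>x. f x * indicator A x)" if "A \<in> sets ?M" for A
      using integrable_mult_indicator[OF that f] by (simp add: mult.commute)
    have "(\<integral>x. f x * indicator T x \<partial>?M) = (\<integral>x. f x * indicator \<Omega> x - f x * indicator (\<Omega> - T) x \<partial>?M)"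
      using T E' by (intro Bochner_Integration.integral_cong) (auto simp: indicator_def)
    also have "\<dots> = 0"
      using integral_open_eq_0_of_orthogonal_C1c[OF \<Omega> f orth \<Omega>]
        integral_open_eq_0_of_orthogonal_C1c[OF \<Omega> f orth open_Diff[OF \<Omega> T(1)]]
      by (subst Bochner_Integration.integral_diff[OF i[OF TM(3)] i[OF TM(2)]]) simp
    finally have "AE x in ?M. f x * indicator T x = 0"
      using i[OF TM(1)] T(2)
      by (subst (asm) integral_nonneg_eq_0_iff_AE) (auto simp: E_def indicator_def less_imp_le intro!: AE_I2)
    then have "AE x in ?M. x \<notin> T"
      by eventually_elim (use T(2) in \<open>auto simp: E_def indicator_def\<close>)
    then have "emeasure ?M T = 0"
      using AE_iff_null_sets[OF TM(1)] by (simp add: null_sets_def)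
    then have T0: "emeasure lebesgue T = 0"
      using T E' \<Omega> by (subst (asm) emeasure_restrict_space) auto
    have "emeasure lebesgue E \<le> emeasure lebesgue (T \<union> (E - T))"
      using T E' by (intro emeasure_mono) auto
    also have "\<dots> \<le> emeasure lebesgue T + emeasure lebesgue (E - T)"
      using T E' by (intro emeasure_subadditive) auto
    finally show ?thesis using T(4) T0 by simp
  qed
  have "emeasure lebesgue E \<le> 0"
    by (rule ennreal_le_epsilon) (simp only: add_0 small)
  then have "emeasure lebesgue E = 0" by simp
  then have "emeasure ?M E = 0" using E' \<Omega> by (subst emeasure_restrict_space) auto
  then have "AE x in ?M. x \<notin> E" using E by (intro AE_not_in) (auto simp: null_sets_def)
  then show ?thesis
    using AE_space by eventually_elim (auto simp: E_def)
qed

lemma fundamental_lemma_calculus_of_variations: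
  fixes f :: "real^2 \<Rightarrow> real"
  assumes "open \<Omega>" "integrable (lebesgue_on \<Omega>) f"
    and "\<And>\<eta>. \<eta> \<in> C1c \<Omega> \<Longrightarrow> (\<integral>x. f x * \<eta> x \<partial>lebesgue_on \<Omega>) = 0"
  shows "AE x in lebesgue_on \<Omega>. f x = 0"
proof -
  have "AE x in lebesgue_on \<Omega>. f x \<le> 0" by (rule AE_nonpos_of_orthogonal_C1c[OF assms])
  moreover have "AE x in lebesgue_on \<Omega>. - f x \<le> 0"
    by (rule AE_nonpos_of_orthogonal_C1c) (use assms in auto)
  ultimately show ?thesis by eventually_elim simp
qed

section \<open>Rotation by a right angle and weak gradients\<close>

lemma L2_iff: "f \<in> L2 \<Omega> \<longleftrightarrow> square_integrable (lebesgue_on \<Omega>) f"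
  by (simp add: L2_def square_integrable_def)

lemma perp_nth [simp]: "perp a $ 1 = a $ 2" "perp a $ 2 = - (a $ 1)"
  by (simp_all add: perp_def vector_def)

lemma perp_perp [simp]: "perp (perp a) = - a"
  by (simp add: vec_eq_iff forall_2)

lemma perp_add: "perp (a + b) = perp a + perp b"
  by (simp add: vec_eq_iff forall_2)

lemma perp_scaleR: "perp (c *\<^sub>R a) = c *\<^sub>R perp a"
  by (simp add: vec_eq_iff forall_2)

lemma perp_zero [simp]: "perp 0 = 0"
  by (simp add: vec_eq_iff forall_2)

lemma inner_perp_perp [simp]: "perp a \<bullet> perp b = a \<bullet> b"
  by (simp add: inner_vec_def sum_2)

lemma inner_perp_left: "perp a \<bullet> b = - (a \<bullet> perp b)"
  by (simp add: inner_vec_def sum_2)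

lemma norm_perp [simp]: "norm (perp a) = norm a"
  by (simp add: norm_eq_sqrt_inner)

lemma linear_perp: "linear perp"
  by (rule linearI) (simp_all add: perp_add perp_scaleR)

lemma borel_measurable_perp [measurable]: "perp \<in> borel_measurable borel"
  by (intro borel_measurable_continuous_onI linear_continuous_on linear_conv_bounded_linear[THEN iffD1] linear_perp)

lemma square_integrable_perp:
  assumes "square_integrable M f"
  shows "square_integrable M (\<lambda>x. perp (f x))"
proof (rule square_integrable_norm_le[OF assms])
  show "(\<lambda>x. perp (f x)) \<in> borel_measurable M"
    by (rule measurable_compose[OF square_integrable_measurable[OF assms] borel_measurable_perp])
qed simp

lemma L2_perp: "v \<in> L2 \<Omega> \<Longrightarrow> (\<lambda>x. perp (v x)) \<in> L2 \<Omega>"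
  by (simp add: L2_iff square_integrable_perp)

lemma integrable_lebesgue_on:
  fixes f :: "'a::euclidean_space \<Rightarrow> real"
  assumes "open \<Omega>" "integrable lborel f"
  shows "integrable (lebesgue_on \<Omega>) f"
proof -
  have "integrable lebesgue f" using assms(2) by (subst integrable_completion) auto
  then have "integrable lebesgue (\<lambda>x. indicator \<Omega> x *\<^sub>R f x)"
    by (intro integrable_mult_indicator) (use assms(1) in auto)
  then show ?thesis by (subst integrable_restrict_space) (use assms(1) in auto)
qed

lemma square_integrable_compact_support:
  fixes f :: "'a::euclidean_space \<Rightarrow> 'b::euclidean_space"
  assumes "open \<Omega>" "continuous_on UNIV f" "compact K" "\<And>x. x \<notin> K \<Longrightarrow> f x = 0"
  shows "square_integrable (lebesgue_on \<Omega>) f"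
  unfolding square_integrable_def
proof
  show "f \<in> borel_measurable (lebesgue_on \<Omega>)"
    by (intro borel_measurable_lebesgue_on borel_measurable_continuous_onI assms)
  show "integrable (lebesgue_on \<Omega>) (\<lambda>x. (norm (f x))\<^sup>2)"
    by (intro integrable_lebesgue_on integrable_compact_support[OF _ assms(3)] continuous_intros assms)
       (simp add: assms)
qed

lemma
  assumes "open \<Omega>" "u \<in> C1c \<Omega>"
  shows square_integrable_C1c: "square_integrable (lebesgue_on \<Omega>) u"
    and square_integrable_grad_C1c: "square_integrable (lebesgue_on \<Omega>) (grad u)"
proof -
  obtain K where K: "compact K" "\<And>x. x \<notin> K \<Longrightarrow> u x = 0" "\<And>x. x \<notin> K \<Longrightarrow> grad u x = 0"
    using assms(2) by (rule C1c_supportE) blast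
  show "square_integrable (lebesgue_on \<Omega>) u" "square_integrable (lebesgue_on \<Omega>) (grad u)"
    using K C1_continuous[OF C1cD[OF assms(2)]] C1_continuous_grad[OF C1cD[OF assms(2)]]
    by (auto intro!: square_integrable_compact_support[OF assms(1)])
qed

lemma C1c_linear_combination:
  assumes "u \<in> C1c \<Omega>" "v \<in> C1c \<Omega>"
  shows "(\<lambda>x. u x + c * v x) \<in> C1c \<Omega>"
    and "grad (\<lambda>x. u x + c * v x) = (\<lambda>x. grad u x + c *\<^sub>R grad v x)"
proof -
  show "(\<lambda>x. u x + c * v x) \<in> C1c \<Omega>"
    by (intro C1c_add C1c_mult C1_const assms)
  show "grad (\<lambda>x. u x + c * v x) = (\<lambda>x. grad u x + c *\<^sub>R grad v x)"
    using grad_add[OF C1cD[OF assms(1)] C1_cmult[OF C1cD[OF assms(2)], of c]]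
    by (simp add: grad_cmult[OF C1cD[OF assms(2)]])
qed

lemma C1c_has_weak_grad:
  assumes "open \<Omega>" "u \<in> C1c \<Omega>"
  shows "has_weak_grad \<Omega> u (grad u)"
  unfolding has_weak_grad_def
proof (intro ballI allI)
  fix \<eta> j assume \<eta>: "\<eta> \<in> C1c \<Omega>"
  note c = C1_continuous[OF C1cD[OF assms(2)]] C1_continuous_grad[OF C1cD[OF assms(2)]]
    C1_continuous[OF C1cD[OF \<eta>]] C1_continuous_grad[OF C1cD[OF \<eta>]]
  have K: "\<eta> x = 0" "grad \<eta> x = 0" if "x \<notin> \<Omega>" for x
    using C1c_eq_0_outside[OF \<eta> that] grad_C1c_eq_0_outside[OF \<eta> that] by auto
  have nth: "v \<bullet> axis j 1 = v $ j" for v :: "real^2" by (simp add: inner_axis)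
  have "(\<integral>x. u x * grad \<eta> x $ j \<partial>lebesgue_on \<Omega>) = (\<integral>x. u x * grad \<eta> x $ j \<partial>lborel)"
    by (rule integral_lebesgue_on_eq_lborel[OF assms(1)]) (use K c in \<open>auto intro!: continuous_intros\<close>)
  also have "\<dots> = - (\<integral>x. grad u x $ j * \<eta> x \<partial>lborel)"
    using integral_by_parts[OF C1cD[OF assms(2)] C1c_subset_UNIV[OF \<eta>], of "axis j 1"] by (simp add: nth)
  also have "(\<integral>x. grad u x $ j * \<eta> x \<partial>lborel) = (\<integral>x. grad u x $ j * \<eta> x \<partial>lebesgue_on \<Omega>)"
    by (rule integral_lebesgue_on_eq_lborel[OF assms(1), symmetric]) (use K c in \<open>auto intro!: continuous_intros\<close>)
  finally show "(\<integral>x. u x * grad \<eta> x $ j \<partial>lebesgue_on \<Omega>) = - (\<integral>x. grad u x $ j * \<eta> x \<partial>lebesgue_on \<Omega>)" .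
qed

lemma has_weak_grad_limit:
  assumes \<Omega>: "open \<Omega>" and F: "\<And>n. has_weak_grad \<Omega> (F n) (G n)"
    and sq: "\<And>n. F n \<in> L2 \<Omega>" "\<And>n. G n \<in> L2 \<Omega>" "\<phi> \<in> L2 \<Omega>" "g \<in> L2 \<Omega>"
    and lim: "tends_in_mean_square (lebesgue_on \<Omega>) F \<phi>" "tends_in_mean_square (lebesgue_on \<Omega>) G g"
  shows "has_weak_grad \<Omega> \<phi> g"
  unfolding has_weak_grad_def
proof (intro ballI allI)
  fix \<eta> j assume \<eta>: "\<eta> \<in> C1c \<Omega>"
  let ?M = "lebesgue_on \<Omega>"
  have sq\<eta>: "square_integrable ?M (\<lambda>x. grad \<eta> x $ j)"
    by (intro square_integrable_nth square_integrable_grad_C1c \<Omega> \<eta>)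
  have sqa: "square_integrable ?M (\<lambda>x. \<eta> x *\<^sub>R axis j (1::real) :: real^2)"
  proof (rule square_integrable_norm_le[OF square_integrable_C1c[OF \<Omega> \<eta>]])
    have [measurable]: "\<eta> \<in> borel_measurable ?M"
      by (rule square_integrable_measurable[OF square_integrable_C1c[OF \<Omega> \<eta>]])
    show "(\<lambda>x. \<eta> x *\<^sub>R axis j (1::real) :: real^2) \<in> borel_measurable ?M" by measurable
  qed simp
  have axis: "v \<bullet> (c *\<^sub>R axis j 1) = v $ j * c" for v :: "real^2" and c by (simp add: inner_axis)
  have eq: "(\<integral>x. F n x * grad \<eta> x $ j \<partial>?M) = - (\<integral>x. G n x $ j * \<eta> x \<partial>?M)" for n
    using F[of n] \<eta> unfolding has_weak_grad_def by blast
  have "(\<lambda>n. \<integral>x. F n x * grad \<eta> x $ j \<partial>?M) \<longlonglongrightarrow> (\<integral>x. \<phi> x * grad \<eta> x $ j \<partial>?M)"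
    using tends_in_mean_square_integral_inner[OF lim(1) _ _ sq\<eta>] sq by (simp add: L2_iff)
  moreover have "(\<lambda>n. - (\<integral>x. G n x $ j * \<eta> x \<partial>?M)) \<longlonglongrightarrow> - (\<integral>x. g x $ j * \<eta> x \<partial>?M)"
    using tends_in_mean_square_integral_inner[OF lim(2) _ _ sqa] sq
    by (intro tendsto_minus) (simp add: L2_iff axis del: inner_scaleR_right)
  ultimately show "(\<integral>x. \<phi> x * grad \<eta> x $ j \<partial>?M) = - (\<integral>x. g x $ j * \<eta> x \<partial>?M)"
    unfolding eq by (rule LIMSEQ_unique)
qed

text \<open>
  The difference of two weak gradients is orthogonal to all test functions.
\<close>
lemma has_weak_grad_unique:
  assumes \<Omega>: "open \<Omega>" "bounded \<Omega>" and g: "g \<in> L2 \<Omega>" "g' \<in> L2 \<Omega>"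
    and w: "has_weak_grad \<Omega> \<phi> g" "has_weak_grad \<Omega> \<phi> g'"
  shows "AE x in lebesgue_on \<Omega>. g x = g' x"
proof -
  let ?M = "lebesgue_on \<Omega>"
  interpret finite_measure ?M by (intro finite_measure_lebesgue_on lmeasurable_open \<Omega>)
  have one: "square_integrable ?M (\<lambda>x. 1::real)" by (simp add: square_integrable_def)
  have sq: "square_integrable ?M (\<lambda>x. g x $ j)" "square_integrable ?M (\<lambda>x. g' x $ j)" for j
    using g by (auto simp: L2_iff intro: square_integrable_nth)
  have "AE x in ?M. g x $ j - g' x $ j = 0" for j
  proof (rule fundamental_lemma_calculus_of_variations[OF \<Omega>(1)])
    show "integrable ?M (\<lambda>x. g x $ j - g' x $ j)"
      using integrable_inner_square_integrable[OF square_integrable_diff[OF sq] one, of j] by simp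
    fix \<eta> assume \<eta>: "\<eta> \<in> C1c \<Omega>"
    have i: "integrable ?M (\<lambda>x. g x $ j * \<eta> x)" "integrable ?M (\<lambda>x. g' x $ j * \<eta> x)"
      using integrable_inner_square_integrable[OF sq(1) square_integrable_C1c[OF \<Omega>(1) \<eta>], of j]
        integrable_inner_square_integrable[OF sq(2) square_integrable_C1c[OF \<Omega>(1) \<eta>], of j] by simp_all
    have "(\<integral>x. \<phi> x * grad \<eta> x $ j \<partial>?M) = - (\<integral>x. g x $ j * \<eta> x \<partial>?M)"
      "(\<integral>x. \<phi> x * grad \<eta> x $ j \<partial>?M) = - (\<integral>x. g' x $ j * \<eta> x \<partial>?M)"
      using w \<eta> unfolding has_weak_grad_def by blast+
    then have "(\<integral>x. g x $ j * \<eta> x \<partial>?M) = (\<integral>x. g' x $ j * \<eta> x \<partial>?M)" by simp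
    then show "(\<integral>x. (g x $ j - g' x $ j) * \<eta> x \<partial>?M) = 0" using i by (simp add: left_diff_distrib)
  qed
  then have "AE x in ?M. \<forall>j. g x $ j - g' x $ j = 0" by (simp add: AE_all_countable)
  then show ?thesis by eventually_elim (simp add: vec_eq_iff)
qed

section \<open>The space of gradients as a closure\<close>

text \<open>
  The definition of \<open>H10 \<Omega>\<close> provides the approximation for one version of the weak gradient,
  and uniqueness transfers it to the given one.
\<close>
lemma G0_imp_limit_of_gradients:
  assumes \<Omega>: "open \<Omega>" "bounded \<Omega>" and g: "g \<in> G0 \<Omega>"
  obtains \<eta> where "\<And>n. \<eta> n \<in> C1c \<Omega>" "tends_in_mean_square (lebesgue_on \<Omega>) (\<lambda>n. grad (\<eta> n)) g"
proof -
  let ?M = "lebesgue_on \<Omega>"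
  obtain \<phi> where \<phi>: "\<phi> \<in> H10 \<Omega>" "has_weak_grad \<Omega> \<phi> g" and gL: "g \<in> L2 \<Omega>"
    using g unfolding G0_def by blast
  obtain g' where g': "g' \<in> L2 \<Omega>" "has_weak_grad \<Omega> \<phi> g'"
    and approx: "\<And>\<epsilon>. \<epsilon> > 0 \<Longrightarrow> \<exists>\<eta>\<in>C1c \<Omega>.
        sqrt (\<integral>x. (\<phi> x - \<eta> x)\<^sup>2 + (norm (g' x - grad \<eta> x))\<^sup>2 \<partial>?M) < \<epsilon>"
    using \<phi>(1) unfolding H10_def by blast
  have \<phi>L: "\<phi> \<in> L2 \<Omega>" using \<phi>(1) unfolding H10_def H1_def by blast
  have "\<forall>n. \<exists>\<eta>. \<eta> \<in> C1c \<Omega> \<and>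
      sqrt (\<integral>x. (\<phi> x - \<eta> x)\<^sup>2 + (norm (g' x - grad \<eta> x))\<^sup>2 \<partial>?M) < inverse (real (Suc n))"
    using approx[OF positive_imp_inverse_positive[OF of_nat_0_less_iff[THEN iffD2, OF zero_less_Suc]]] by blast
  from choice[OF this] obtain \<eta> where \<eta>: "\<And>n. \<eta> n \<in> C1c \<Omega>"
    "\<And>n. sqrt (\<integral>x. (\<phi> x - \<eta> n x)\<^sup>2 + (norm (g' x - grad (\<eta> n) x))\<^sup>2 \<partial>?M) < inverse (real (Suc n))"
    by blast
  have le: "(\<integral>x. (norm (grad (\<eta> n) x - g' x))\<^sup>2 \<partial>?M) \<le> (inverse (real (Suc n)))\<^sup>2" for n
  proof -
    have i: "integrable ?M (\<lambda>x. (\<phi> x - \<eta> n x)\<^sup>2)" "integrable ?M (\<lambda>x. (norm (g' x - grad (\<eta> n) x))\<^sup>2)"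
      using square_integrable_norm_square[OF square_integrable_diff[OF \<phi>L[unfolded L2_iff] square_integrable_C1c[OF \<Omega>(1) \<eta>(1)]]]
        square_integrable_norm_square[OF square_integrable_diff[OF g'(1)[unfolded L2_iff] square_integrable_grad_C1c[OF \<Omega>(1) \<eta>(1)]]]
      by simp_all
    have "(\<integral>x. (norm (grad (\<eta> n) x - g' x))\<^sup>2 \<partial>?M) = (\<integral>x. (norm (g' x - grad (\<eta> n) x))\<^sup>2 \<partial>?M)"
      by (simp add: norm_minus_commute)
    also have "\<dots> \<le> (\<integral>x. (\<phi> x - \<eta> n x)\<^sup>2 + (norm (g' x - grad (\<eta> n) x))\<^sup>2 \<partial>?M)"
      using i by (intro integral_mono Bochner_Integration.integrable_add) auto
    also have "\<dots> \<le> (inverse (real (Suc n)))\<^sup>2"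
      by (rule sqrt_le_D[OF less_imp_le[OF \<eta>(2)]])
    finally show ?thesis .
  qed
  have lim: "(\<lambda>n. (inverse (real (Suc n)))\<^sup>2) \<longlonglongrightarrow> 0"
    using tendsto_power[OF LIMSEQ_inverse_real_of_nat, of 2] by simp
  have "tends_in_mean_square ?M (\<lambda>n. grad (\<eta> n)) g'"
    unfolding tends_in_mean_square_def
    by (rule tendsto_sandwich[OF _ _ tendsto_const lim]) (use le in simp_all)
  then have "tends_in_mean_square ?M (\<lambda>n. grad (\<eta> n)) g"
    using has_weak_grad_unique[OF \<Omega> g'(1) gL g'(2) \<phi>(2)] square_integrable_grad_C1c[OF \<Omega>(1) \<eta>(1)] g'(1) gL
    unfolding L2_iff by (rule tends_in_mean_square_cong_AE)
  with \<eta>(1) that show ?thesis by blast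
qed

text \<open>
  By the Poincare inequality the functions \<open>\<eta> n\<close> converge as well, and weak gradients pass to
  the limit.
\<close>
lemma limit_of_gradients_imp_G0:
  assumes \<Omega>: "open \<Omega>" "bounded \<Omega>" and g: "g \<in> L2 \<Omega>" and \<eta>: "\<And>n. \<eta> n \<in> C1c \<Omega>"
    and lim: "tends_in_mean_square (lebesgue_on \<Omega>) (\<lambda>n. grad (\<eta> n)) g"
  shows "g \<in> G0 \<Omega>"
proof -
  let ?M = "lebesgue_on \<Omega>"
  note g' = g[unfolded L2_iff]
  have fin: "finite_measure ?M" by (intro finite_measure_lebesgue_on lmeasurable_open \<Omega>)
  note sq = square_integrable_C1c[OF \<Omega>(1) \<eta>] and sqg = square_integrable_grad_C1c[OF \<Omega>(1) \<eta>]
  obtain C where C: "C \<ge> 0"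
    "\<And>u. u \<in> C1c \<Omega> \<Longrightarrow> (\<integral>x. (u x)\<^sup>2 \<partial>lborel) \<le> C * (\<integral>x. (norm (grad u x))\<^sup>2 \<partial>lborel)"
    using Poincare_inequality[OF \<Omega>(2)] by blast
  define a where "a n = (\<integral>x. (norm (grad (\<eta> n) x - g x))\<^sup>2 \<partial>?M)" for n
  have a: "a \<longlonglongrightarrow> 0" using lim unfolding a_def tends_in_mean_square_def .
  have P: "(\<integral>x. (norm (\<eta> m x - \<eta> n x))\<^sup>2 \<partial>?M) \<le> C * (2 * a m + 2 * a n)" for m n
  proof -
    define u where "u x = \<eta> m x + (- 1) * \<eta> n x" for x
    have u: "u \<in> C1c \<Omega>" and gu: "grad u = (\<lambda>x. grad (\<eta> m) x - grad (\<eta> n) x)"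
      using C1c_linear_combination[OF \<eta> \<eta>, of m "-1" n] unfolding u_def[symmetric] by simp_all
    note K = C1c_eq_0_outside[OF u] grad_C1c_eq_0_outside[OF u]
    have c: "continuous_on UNIV u" "continuous_on UNIV (grad u)"
      using C1cD[OF u] by (auto intro: C1_continuous C1_continuous_grad)
    have "(\<integral>x. (norm (\<eta> m x - \<eta> n x))\<^sup>2 \<partial>?M) = (\<integral>x. (u x)\<^sup>2 \<partial>?M)" by (simp add: u_def)
    also have "\<dots> = (\<integral>x. (u x)\<^sup>2 \<partial>lborel)"
      by (rule integral_lebesgue_on_eq_lborel[OF \<Omega>(1)]) (use c K in \<open>auto intro!: continuous_intros\<close>)
    also have "\<dots> \<le> C * (\<integral>x. (norm (grad u x))\<^sup>2 \<partial>lborel)" by (rule C(2)[OF u])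
    also have "(\<integral>x. (norm (grad u x))\<^sup>2 \<partial>lborel) = (\<integral>x. (norm (grad u x))\<^sup>2 \<partial>?M)"
      by (rule integral_lebesgue_on_eq_lborel[OF \<Omega>(1), symmetric]) (use c K in \<open>auto intro!: continuous_intros\<close>)
    also have "(\<integral>x. (norm (grad u x))\<^sup>2 \<partial>?M) \<le> 2 * a m + 2 * a n"
    proof -
      note i = square_integrable_norm_square[OF square_integrable_diff[OF sqg g']]
      have "(\<integral>x. (norm (grad u x))\<^sup>2 \<partial>?M)
          \<le> (\<integral>x. 2 * (norm (grad (\<eta> m) x - g x))\<^sup>2 + 2 * (norm (grad (\<eta> n) x - g x))\<^sup>2 \<partial>?M)"
      proof (rule integral_mono)
        show "integrable ?M (\<lambda>x. (norm (grad u x))\<^sup>2)"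
          by (intro square_integrable_norm_square square_integrable_grad_C1c \<Omega> u)
        show "(norm (grad u x))\<^sup>2 \<le> 2 * (norm (grad (\<eta> m) x - g x))\<^sup>2 + 2 * (norm (grad (\<eta> n) x - g x))\<^sup>2" for x
          using norm_diff_square_le[of "grad (\<eta> m) x - g x" "grad (\<eta> n) x - g x"] by (simp add: gu)
      qed (use i in simp)
      then show ?thesis using i by (simp add: a_def)
    qed
    finally show ?thesis using C(1) by (simp add: mult_left_mono)
  qed
  have Cauchy: "\<exists>N. \<forall>m\<ge>N. \<forall>n\<ge>N. (\<integral>x. (norm (\<eta> m x - \<eta> n x))\<^sup>2 \<partial>?M) \<le> e" if e: "e > 0" for e
  proof -
    have "(\<lambda>n. C * (4 * a n)) \<longlonglongrightarrow> C * (4 * 0)" by (intro tendsto_intros a)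
    then have "\<forall>\<^sub>F n in sequentially. C * (4 * a n) < e" using e by (simp add: order_tendstoD)
    then obtain N where N: "\<And>n. n \<ge> N \<Longrightarrow> C * (4 * a n) < e" by (auto simp: eventually_sequentially)
    have "(\<integral>x. (norm (\<eta> m x - \<eta> n x))\<^sup>2 \<partial>?M) \<le> e" if "m \<ge> N" "n \<ge> N" for m n
      using P[of m n] N[OF that(1)] N[OF that(2)] by (simp add: algebra_simps)
    then show ?thesis by blast
  qed
  obtain \<phi> where \<phi>: "square_integrable ?M \<phi>" "tends_in_mean_square ?M \<eta> \<phi>"
    using Riesz_Fischer[OF fin sq Cauchy] by blast
  have w: "has_weak_grad \<Omega> \<phi> g"
    by (rule has_weak_grad_limit[OF \<Omega>(1) C1c_has_weak_grad[OF \<Omega>(1) \<eta>]])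
       (use sq sqg \<phi> g lim in \<open>auto simp: L2_iff\<close>)
  have "\<forall>\<epsilon>>0. \<exists>\<eta>\<in>C1c \<Omega>. sqrt (\<integral>x. (\<phi> x - \<eta> x)\<^sup>2 + (norm (g x - grad \<eta> x))\<^sup>2 \<partial>?M) < \<epsilon>"
  proof (intro allI impI)
    fix \<epsilon> :: real assume \<epsilon>: "\<epsilon> > 0"
    have "(\<lambda>n. (\<integral>x. (norm (\<eta> n x - \<phi> x))\<^sup>2 \<partial>?M) + a n) \<longlonglongrightarrow> 0 + 0"
      using \<phi>(2) a unfolding tends_in_mean_square_def by (rule tendsto_add)
    then have "\<forall>\<^sub>F n in sequentially. (\<integral>x. (norm (\<eta> n x - \<phi> x))\<^sup>2 \<partial>?M) + a n < \<epsilon>\<^sup>2"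
      using \<epsilon> by (simp add: order_tendstoD)
    then obtain n where n: "(\<integral>x. (norm (\<eta> n x - \<phi> x))\<^sup>2 \<partial>?M) + a n < \<epsilon>\<^sup>2"
      by (auto simp: eventually_sequentially)
    have "(\<integral>x. (\<phi> x - \<eta> n x)\<^sup>2 + (norm (g x - grad (\<eta> n) x))\<^sup>2 \<partial>?M)
        = (\<integral>x. (norm (\<eta> n x - \<phi> x))\<^sup>2 + (norm (grad (\<eta> n) x - g x))\<^sup>2 \<partial>?M)"
      by (simp add: norm_minus_commute power2_commute)
    also have "\<dots> = (\<integral>x. (norm (\<eta> n x - \<phi> x))\<^sup>2 \<partial>?M) + a n"
      unfolding a_def
      by (intro Bochner_Integration.integral_add square_integrable_norm_square square_integrable_diff sq sqg \<phi> g')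
    finally have "sqrt (\<integral>x. (\<phi> x - \<eta> n x)\<^sup>2 + (norm (g x - grad (\<eta> n) x))\<^sup>2 \<partial>?M) < \<epsilon>"
      using n \<epsilon> by (intro real_less_lsqrt) auto
    with \<eta> show "\<exists>\<eta>\<in>C1c \<Omega>. sqrt (\<integral>x. (\<phi> x - \<eta> x)\<^sup>2 + (norm (g x - grad \<eta> x))\<^sup>2 \<partial>?M) < \<epsilon>"
      by blast
  qed
  moreover have "\<phi> \<in> H1 \<Omega>" using \<phi>(1)[folded L2_iff] g w unfolding H1_def by blast
  ultimately have "\<phi> \<in> H10 \<Omega>" using g w unfolding H10_def by blast
  with g w show ?thesis unfolding G0_def by blast
qed

section \<open>Subspaces and their orthogonality\<close>

lemma
  assumes "L2_subspace \<Omega> U"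
  shows L2_subspace_subset: "U \<subseteq> L2 \<Omega>"
    and L2_subspace_zero: "(\<lambda>x. 0) \<in> U"
    and L2_subspace_add: "u \<in> U \<Longrightarrow> v \<in> U \<Longrightarrow> (\<lambda>x. u x + v x) \<in> U"
    and L2_subspace_scaleR: "u \<in> U \<Longrightarrow> (\<lambda>x. c *\<^sub>R u x) \<in> U"
    and L2_subspace_cong: "u \<in> U \<Longrightarrow> w \<in> L2 \<Omega> \<Longrightarrow> L2_eq \<Omega> u w \<Longrightarrow> w \<in> U"
  using assms unfolding L2_subspace_def by blast+

lemma L2_subspace_uminus: "L2_subspace \<Omega> U \<Longrightarrow> u \<in> U \<Longrightarrow> (\<lambda>x. - u x) \<in> U"
  using L2_subspace_scaleR[of \<Omega> U u "- 1"] by simp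

lemma L2_subspace_diff:
  "L2_subspace \<Omega> U \<Longrightarrow> u \<in> U \<Longrightarrow> v \<in> U \<Longrightarrow> (\<lambda>x. u x - v x) \<in> U"
  using L2_subspace_add[of \<Omega> U u "\<lambda>x. - v x"] L2_subspace_uminus[of \<Omega> U v] by simp

text \<open>
  Sums and multiples of limits of gradients are limits of gradients, by linearity of \<open>grad\<close>; the
  description as a closure avoids handling the potentials in \<open>H10 \<Omega>\<close>.
\<close>
lemma L2_subspace_G0:
  assumes \<Omega>: "open \<Omega>" "bounded \<Omega>"
  shows "L2_subspace \<Omega> (G0 \<Omega>)"
  unfolding L2_subspace_def
proof (intro conjI ballI allI impI)
  let ?M = "lebesgue_on \<Omega>"
  note sqg = square_integrable_grad_C1c[OF \<Omega>(1)]
  show sub: "G0 \<Omega> \<subseteq> L2 \<Omega>" by (auto simp: G0_def)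
  show "(\<lambda>x. 0) \<in> G0 \<Omega>"
    by (rule limit_of_gradients_imp_G0[OF \<Omega>, where \<eta>="\<lambda>n x. 0"])
       (auto simp: C1c_zero grad_const tends_in_mean_square_def L2_iff square_integrable_def)
  fix u assume u: "u \<in> G0 \<Omega>"
  then have uL: "square_integrable ?M u" using sub by (auto simp: L2_iff)
  obtain \<eta> where \<eta>: "\<And>n. \<eta> n \<in> C1c \<Omega>" "tends_in_mean_square ?M (\<lambda>n. grad (\<eta> n)) u"
    using G0_imp_limit_of_gradients[OF \<Omega> u] by blast
  show "(\<lambda>x. u x + v x) \<in> G0 \<Omega>" if v: "v \<in> G0 \<Omega>" for v
  proof -
    have vL: "square_integrable ?M v" using v sub by (auto simp: L2_iff)
    obtain \<zeta> where \<zeta>: "\<And>n. \<zeta> n \<in> C1c \<Omega>" "tends_in_mean_square ?M (\<lambda>n. grad (\<zeta> n)) v"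
      using G0_imp_limit_of_gradients[OF \<Omega> v] by blast
    have "tends_in_mean_square ?M (\<lambda>n x. grad (\<eta> n) x + grad (\<zeta> n) x) (\<lambda>x. u x + v x)"
      by (intro tends_in_mean_square_add \<eta> \<zeta> sqg uL vL)
    then have "tends_in_mean_square ?M (\<lambda>n. grad (\<lambda>x. \<eta> n x + \<zeta> n x)) (\<lambda>x. u x + v x)"
      by (simp add: grad_add[OF C1cD[OF \<eta>(1)] C1cD[OF \<zeta>(1)]])
    then show ?thesis
      using limit_of_gradients_imp_G0[OF \<Omega> _ C1c_add[OF \<eta>(1) \<zeta>(1)]] square_integrable_add[OF uL vL]
      by (simp add: L2_iff)
  qed
  show "(\<lambda>x. c *\<^sub>R u x) \<in> G0 \<Omega>" for c
  proof -
    have "tends_in_mean_square ?M (\<lambda>n. grad (\<lambda>x. c * \<eta> n x)) (\<lambda>x. c *\<^sub>R u x)"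
      using tends_in_mean_square_scaleR[OF \<eta>(2)] by (simp add: grad_cmult[OF C1cD[OF \<eta>(1)]])
    then show ?thesis
      using limit_of_gradients_imp_G0[OF \<Omega> _ C1c_mult[OF C1_const \<eta>(1)]] square_integrable_scaleR[OF uL]
      by (simp add: L2_iff)
  qed
  show "v \<in> G0 \<Omega>" if v: "v \<in> L2 \<Omega>" "L2_eq \<Omega> u v" for v
    by (rule limit_of_gradients_imp_G0[OF \<Omega> v(1) \<eta>(1)],
        rule tends_in_mean_square_cong_AE[OF \<eta>(2) v(2)[unfolded L2_eq_def] sqg[OF \<eta>(1)] uL])
       (use v in \<open>simp add: L2_iff\<close>)
qed

lemma L2_subspace_perp_image:
  assumes U: "L2_subspace \<Omega> U"
  shows "L2_subspace \<Omega> {(\<lambda>x. perp (u x)) |u. u \<in> U}" (is "L2_subspace \<Omega> ?V")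
  unfolding L2_subspace_def
proof (intro conjI ballI allI impI)
  have mem: "(\<lambda>x. perp (u x)) \<in> ?V" if "u \<in> U" for u using that by blast
  show "?V \<subseteq> L2 \<Omega>" using L2_subspace_subset[OF U] L2_perp by blast
  show "(\<lambda>x. 0) \<in> ?V" using mem[OF L2_subspace_zero[OF U]] by (simp only: perp_zero)
  fix v assume "v \<in> ?V"
  then obtain u where u: "u \<in> U" "v = (\<lambda>x. perp (u x))" by blast
  show "(\<lambda>x. v x + v' x) \<in> ?V" if v': "v' \<in> ?V" for v'
  proof -
    obtain u' where u': "u' \<in> U" "v' = (\<lambda>x. perp (u' x))" using v' by blast
    show ?thesis
      using mem[OF L2_subspace_add[OF U u(1) u'(1)]] unfolding u(2) u'(2) by (simp only: perp_add)
  qed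
  show "(\<lambda>x. c *\<^sub>R v x) \<in> ?V" for c
    using mem[OF L2_subspace_scaleR[OF U u(1)]] unfolding u(2) by (simp only: perp_scaleR)
  show "v' \<in> ?V" if v': "v' \<in> L2 \<Omega>" "L2_eq \<Omega> v v'" for v'
  proof -
    have "(\<lambda>x. perp (- v' x)) \<in> L2 \<Omega>"
      using square_integrable_perp[OF square_integrable_scaleR[of "lebesgue_on \<Omega>" v' "- 1"]] v'(1)
      by (simp add: L2_iff)
    moreover have "L2_eq \<Omega> u (\<lambda>x. perp (- v' x))"
      using v'(2) unfolding L2_eq_def u(2)
    proof eventually_elim
      case (elim x)
      show ?case unfolding elim[symmetric] by (simp add: vec_eq_iff forall_2)
    qed
    ultimately have "(\<lambda>x. perp (- v' x)) \<in> U" by (rule L2_subspace_cong[OF U u(1)])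
    from mem[OF this] show ?thesis by simp
  qed
qed

lemma Curl0_eq_perp_G0: "Curl0 \<Omega> = {(\<lambda>x. perp (g x)) |g. g \<in> G0 \<Omega>}"
  by (auto simp: Curl0_def G0_def)

lemma L2_subspace_orthogonal_complement:
  assumes "T \<subseteq> L2 \<Omega>"
  shows "L2_subspace \<Omega> {v \<in> L2 \<Omega>. \<forall>t\<in>T. L2_inner \<Omega> t v = 0}"
  unfolding L2_subspace_def
proof (intro conjI ballI allI impI)
  let ?V = "{v \<in> L2 \<Omega>. \<forall>t\<in>T. L2_inner \<Omega> t v = 0}"
  have i: "integrable (lebesgue_on \<Omega>) (\<lambda>x. t x \<bullet> v x)" if "t \<in> T" "v \<in> L2 \<Omega>" for t v
    using that assms by (auto simp: L2_iff intro!: integrable_inner_square_integrable)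
  show "?V \<subseteq> L2 \<Omega>" by auto
  show "(\<lambda>x. 0) \<in> ?V" by (simp add: L2_iff square_integrable_def L2_inner_def)
  fix u assume u: "u \<in> ?V"
  show "(\<lambda>x. u x + v x) \<in> ?V" if "v \<in> ?V" for v
    using u that i by (auto simp: L2_iff square_integrable_add L2_inner_def inner_add_right)
  show "(\<lambda>x. c *\<^sub>R u x) \<in> ?V" for c
    using u by (auto simp: L2_iff square_integrable_scaleR L2_inner_def)
  show "v \<in> ?V" if v: "v \<in> L2 \<Omega>" "L2_eq \<Omega> u v" for v
  proof -
    have "L2_inner \<Omega> t v = L2_inner \<Omega> t u" if t: "t \<in> T" for t
      unfolding L2_inner_def
    proof (rule integral_cong_AE)
      show "AE x in lebesgue_on \<Omega>. t x \<bullet> v x = t x \<bullet> u x"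
        using v(2) unfolding L2_eq_def by eventually_elim simp
    qed (use i[OF t] u v in auto)
    then show ?thesis using u v by auto
  qed
qed

lemma N_div_eq: "N_div \<Omega> = {v \<in> L2 \<Omega>. \<forall>t\<in>grad ` C1c \<Omega>. L2_inner \<Omega> t v = 0}"
  by (auto simp: N_div_def solenoidal_def L2_inner_def)

lemma N_curl_eq: "N_curl \<Omega> = {v \<in> L2 \<Omega>. \<forall>t\<in>perp_grad ` C1c \<Omega>. L2_inner \<Omega> t v = 0}"
  by (auto simp: N_curl_def irrotational_def L2_inner_def)

lemma harmonic_fields_eq: "harmonic_fields \<Omega> = N_curl \<Omega> \<inter> N_div \<Omega>"
  by (auto simp: harmonic_fields_def N_curl_def N_div_def)

text \<open>
  Since \<open>perp\<close> preserves inner products, rotating the field and the test gradients together changes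
  nothing.
\<close>
lemma perp_mem_N_curl_iff: "(\<lambda>x. perp (v x)) \<in> N_curl \<Omega> \<longleftrightarrow> v \<in> N_div \<Omega>"
proof -
  have "v \<in> L2 \<Omega>" if "(\<lambda>x. perp (v x)) \<in> L2 \<Omega>"
    using square_integrable_scaleR[of _ "\<lambda>x. perp (perp (v x))" "-1"] L2_perp[OF that]
    by (simp add: L2_iff)
  then show ?thesis
    by (auto simp: N_curl_def N_div_def irrotational_def solenoidal_def perp_grad_def L2_perp)
qed

lemma L2_subspace_Int:
  "L2_subspace \<Omega> U \<Longrightarrow> L2_subspace \<Omega> V \<Longrightarrow> L2_subspace \<Omega> (U \<inter> V)"
  by (auto simp: L2_subspace_def)

lemma L2_inner_commute: "L2_inner \<Omega> u v = L2_inner \<Omega> v u"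
  by (simp add: L2_inner_def inner_commute)

lemma G0_orthogonal_N_div:
  assumes \<Omega>: "open \<Omega>" "bounded \<Omega>" and g: "g \<in> G0 \<Omega>" and v: "v \<in> N_div \<Omega>"
  shows "L2_inner \<Omega> g v = 0"
proof -
  obtain \<eta> where \<eta>: "\<And>n. \<eta> n \<in> C1c \<Omega>" "tends_in_mean_square (lebesgue_on \<Omega>) (\<lambda>n. grad (\<eta> n)) g"
    using G0_imp_limit_of_gradients[OF \<Omega> g] by blast
  have "(\<lambda>n. \<integral>x. grad (\<eta> n) x \<bullet> v x \<partial>lebesgue_on \<Omega>) \<longlonglongrightarrow> L2_inner \<Omega> g v"
    unfolding L2_inner_def
    by (rule tends_in_mean_square_integral_inner[OF \<eta>(2) square_integrable_grad_C1c[OF \<Omega>(1) \<eta>(1)]])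
       (use g v in \<open>auto simp: G0_def N_div_def L2_iff\<close>)
  moreover have "(\<integral>x. grad (\<eta> n) x \<bullet> v x \<partial>lebesgue_on \<Omega>) = 0" for n
    using v \<eta>(1) by (auto simp: N_div_def solenoidal_def)
  ultimately show ?thesis by (simp add: LIMSEQ_const_iff)
qed

text \<open>
  Up to sign the integrand is the Jacobian determinant of \<open>u\<close> and \<open>v\<close>.
\<close>
lemma perp_grad_orthogonal_grad:
  assumes \<Omega>: "open \<Omega>" and u: "u \<in> C1c \<Omega>" and v: "v \<in> C1c \<Omega>"
  shows "(\<integral>x. perp_grad u x \<bullet> grad v x \<partial>lebesgue_on \<Omega>) = 0"
proof -
  let ?e = "\<lambda>j::2. axis j (1::real)"
  have cu: "continuous_on UNIV (grad u)" and cv: "continuous_on UNIV (grad v)"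
    by (intro C1_continuous_grad C1cD[OF u] C1cD[OF v])+
  note K = grad_C1c_eq_0_outside[OF v]
  have eq: "perp_grad u x \<bullet> grad v x
      = (grad u x \<bullet> ?e 2) * (grad v x \<bullet> ?e 1) - (grad u x \<bullet> ?e 1) * (grad v x \<bullet> ?e 2)" for x
    by (simp add: perp_grad_def inner_vec_def[of "perp _"] sum_2 inner_axis)
  have i: "integrable lborel (\<lambda>x. (grad u x \<bullet> a) * (grad v x \<bullet> b))" for a b
    by (rule integrable_C1c(2)[OF v]) (intro continuous_intros cu)
  have "(\<integral>x. perp_grad u x \<bullet> grad v x \<partial>lebesgue_on \<Omega>) = (\<integral>x. perp_grad u x \<bullet> grad v x \<partial>lborel)"
    unfolding eq
    by (rule integral_lebesgue_on_eq_lborel[OF \<Omega>]) (use K cu cv in \<open>auto intro!: continuous_intros\<close>)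
  also have "\<dots> = 0"
    unfolding eq using i integral_grad_grad_commute[OF C1c_subset_UNIV[OF u] C1c_subset_UNIV[OF v], of "?e 2" "?e 1"]
    by simp
  finally show ?thesis .
qed

lemma G0_subset_N_curl:
  assumes \<Omega>: "open \<Omega>" "bounded \<Omega>"
  shows "G0 \<Omega> \<subseteq> N_curl \<Omega>"
proof
  fix g assume g: "g \<in> G0 \<Omega>"
  let ?M = "lebesgue_on \<Omega>"
  have "(\<integral>x. perp_grad u x \<bullet> g x \<partial>?M) = 0" if u: "u \<in> C1c \<Omega>" for u
  proof -
    have sq: "square_integrable ?M (perp_grad u)"
      using square_integrable_perp[OF square_integrable_grad_C1c[OF \<Omega>(1) u]]
      by (simp add: perp_grad_def[abs_def])
    obtain \<eta> where \<eta>: "\<And>n. \<eta> n \<in> C1c \<Omega>" "tends_in_mean_square ?M (\<lambda>n. grad (\<eta> n)) g"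
      using G0_imp_limit_of_gradients[OF \<Omega> g] by blast
    have "(\<lambda>n. \<integral>x. grad (\<eta> n) x \<bullet> perp_grad u x \<partial>?M) \<longlonglongrightarrow> (\<integral>x. g x \<bullet> perp_grad u x \<partial>?M)"
      by (rule tends_in_mean_square_integral_inner[OF \<eta>(2) square_integrable_grad_C1c[OF \<Omega>(1) \<eta>(1)] _ sq])
         (use g in \<open>auto simp: G0_def L2_iff\<close>)
    then show ?thesis
      using perp_grad_orthogonal_grad[OF \<Omega>(1) u \<eta>(1)] by (simp add: inner_commute LIMSEQ_const_iff)
  qed
  with g show "g \<in> N_curl \<Omega>" by (auto simp: N_curl_def irrotational_def G0_def)
qed

section \<open>The decompositions\<close>

lemma exists_G0_N_div_decomposition:
  assumes \<Omega>: "open \<Omega>" "bounded \<Omega>" and w: "w \<in> L2 \<Omega>"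
  obtains g where "g \<in> G0 \<Omega>" "(\<lambda>x. w x - g x) \<in> N_div \<Omega>"
proof -
  let ?M = "lebesgue_on \<Omega>" and ?V = "grad ` C1c \<Omega>"
  have fin: "finite_measure ?M" by (intro finite_measure_lebesgue_on lmeasurable_open \<Omega>)
  have V: "?V \<noteq> {}" "\<And>v. v \<in> ?V \<Longrightarrow> square_integrable ?M v"
    "\<And>u v c. u \<in> ?V \<Longrightarrow> v \<in> ?V \<Longrightarrow> (\<lambda>x. u x + c *\<^sub>R v x) \<in> ?V"
    "\<And>v c. v \<in> ?V \<Longrightarrow> (\<lambda>x. c *\<^sub>R v x) \<in> ?V"
  proof -
    show "?V \<noteq> {}" using C1c_zero by auto
    show "\<And>v. v \<in> ?V \<Longrightarrow> square_integrable ?M v" using square_integrable_grad_C1c[OF \<Omega>(1)] by auto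
    show "(\<lambda>x. f x + c *\<^sub>R h x) \<in> ?V" if f: "f \<in> ?V" and h: "h \<in> ?V" for f h c
    proof -
      obtain u v where u: "u \<in> C1c \<Omega>" "f = grad u" and v: "v \<in> C1c \<Omega>" "h = grad v"
        using f h by blast
      show ?thesis
        unfolding u(2) v(2) C1c_linear_combination(2)[OF u(1) v(1), symmetric]
        by (rule imageI, rule C1c_linear_combination(1)[OF u(1) v(1)])
    qed
    show "(\<lambda>x. c *\<^sub>R f x) \<in> ?V" if f: "f \<in> ?V" for f c
    proof -
      obtain u where u: "u \<in> C1c \<Omega>" "f = grad u" using f by blast
      show ?thesis
        unfolding u(2) grad_cmult[OF C1cD[OF u(1)], symmetric]
        by (rule imageI, rule C1c_mult[OF C1_const u(1)])
    qed
  qed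
  obtain F g where F: "\<And>n. F n \<in> ?V" and g: "square_integrable ?M g" "tends_in_mean_square ?M F g"
    and orth: "\<And>v. v \<in> ?V \<Longrightarrow> (\<integral>x. (w x - g x) \<bullet> v x \<partial>?M) = 0"
    using projection_onto_mean_square_closure[OF fin w[unfolded L2_iff] V] by blast
  have "\<forall>n. \<exists>\<eta>. \<eta> \<in> C1c \<Omega> \<and> F n = grad \<eta>" using F by blast
  from choice[OF this] obtain \<eta> where \<eta>: "\<And>n. \<eta> n \<in> C1c \<Omega>" "\<And>n. F n = grad (\<eta> n)" by blast
  have "F = (\<lambda>n. grad (\<eta> n))" using \<eta>(2) by auto
  with g have "g \<in> G0 \<Omega>" by (intro limit_of_gradients_imp_G0[OF \<Omega> _ \<eta>(1)]) (auto simp: L2_iff)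
  moreover have "(\<lambda>x. w x - g x) \<in> N_div \<Omega>"
    using orth square_integrable_diff[OF w[unfolded L2_iff] g(1)]
    by (auto simp: N_div_def L2_iff solenoidal_def inner_commute)
  ultimately show ?thesis using that by blast
qed

text \<open>
  Rotate the field, decompose it, and rotate back; the sign comes from \<open>perp (perp a) = - a\<close>.
\<close>
lemma exists_Curl0_N_curl_decomposition:
  assumes \<Omega>: "open \<Omega>" "bounded \<Omega>" and w: "w \<in> L2 \<Omega>"
  obtains c where "c \<in> Curl0 \<Omega>" "(\<lambda>x. w x - c x) \<in> N_curl \<Omega>"
proof -
  obtain g where g: "g \<in> G0 \<Omega>" "(\<lambda>x. perp (w x) - g x) \<in> N_div \<Omega>"
    using exists_G0_N_div_decomposition[OF \<Omega> L2_perp[OF w]] by blast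
  have "L2_subspace \<Omega> (N_div \<Omega>)"
    unfolding N_div_eq using square_integrable_grad_C1c[OF \<Omega>(1)]
    by (intro L2_subspace_orthogonal_complement) (auto simp: L2_iff)
  from L2_subspace_uminus[OF this g(2)]
  have "(\<lambda>x. perp (- (perp (w x) - g x))) \<in> N_curl \<Omega>" by (simp only: perp_mem_N_curl_iff)
  moreover have "perp (- (perp (w x) - g x)) = w x - perp (- g x)" for x
    by (simp add: vec_eq_iff forall_2)
  ultimately have "(\<lambda>x. w x - perp (- g x)) \<in> N_curl \<Omega>" by simp
  moreover have "(\<lambda>x. perp (- g x)) \<in> Curl0 \<Omega>"
    using L2_subspace_uminus[OF L2_subspace_G0[OF \<Omega>] g(1)] unfolding Curl0_eq_perp_G0
    by (intro CollectI exI[of _ "\<lambda>x. - g x"] conjI refl)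
  ultimately show ?thesis using that by blast
qed

text \<open>
  Uniqueness comes for free: if components \<open>d i\<close> of mutually orthogonal subspaces add up to
  zero, then the inner product of their sum with \<open>d k\<close> is the square norm of \<open>d k\<close>.
\<close>
lemma L2_orthogonal_direct_sumI:
  assumes sub: "\<And>U. U \<in> set Us \<Longrightarrow> L2_subspace \<Omega> U"
    and orth: "\<And>i j u v. i < j \<Longrightarrow> j < length Us \<Longrightarrow> u \<in> Us ! i \<Longrightarrow> v \<in> Us ! j \<Longrightarrow> L2_inner \<Omega> u v = 0"
    and ex: "\<And>w. w \<in> L2 \<Omega> \<Longrightarrow> \<exists>u. (\<forall>i<length Us. u i \<in> Us ! i) \<and> L2_eq \<Omega> w (\<lambda>x. \<Sum>i<length Us. u i x)"
  shows "L2_orthogonal_direct_sum \<Omega> Us"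
proof -
  let ?M = "lebesgue_on \<Omega>" and ?n = "length Us"
  have orth': "L2_inner \<Omega> u v = 0" if "i < ?n" "j < ?n" "i \<noteq> j" "u \<in> Us ! i" "v \<in> Us ! j" for i j u v
  proof (cases "i < j")
    case True
    then show ?thesis using that(2,4,5) by (rule orth)
  next
    case False
    then have "j < i" using that(3) by simp
    then have vu: "L2_inner \<Omega> v u = 0" using that(1,5,4) by (rule orth)
    then show ?thesis using L2_inner_commute[of \<Omega> u v] by simp
  qed
  have unique: "L2_eq \<Omega> (u' k) (u k)"
    if u: "\<forall>i<?n. u i \<in> Us ! i" "L2_eq \<Omega> w (\<lambda>x. \<Sum>i<?n. u i x)"
      and u': "\<forall>i<?n. u' i \<in> Us ! i" "L2_eq \<Omega> w (\<lambda>x. \<Sum>i<?n. u' i x)" and k: "k < ?n"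
    for w u u' k
  proof -
    define d where "d i = (\<lambda>x. u' i x - u i x)" for i
    have d: "d i \<in> Us ! i" "square_integrable ?M (d i)" if i: "i < ?n" for i
    proof -
      have s: "L2_subspace \<Omega> (Us ! i)" using sub i by simp
      show "d i \<in> Us ! i" unfolding d_def
        using u(1) u'(1) i by (intro L2_subspace_diff[OF s]) simp_all
      then show "square_integrable ?M (d i)" using L2_subspace_subset[OF s] by (auto simp: L2_iff)
    qed
    have int: "integrable ?M (\<lambda>x. d i x \<bullet> d k x)" if "i < ?n" for i
      by (intro integrable_inner_square_integrable d that k)
    have "AE x in ?M. (\<Sum>i<?n. d i x) = 0"
      using u(2) u'(2) unfolding L2_eq_def
      by eventually_elim (simp add: d_def sum_subtractf)
    then have "AE x in ?M. (\<Sum>i<?n. d i x \<bullet> d k x) = 0"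
      by eventually_elim (simp flip: inner_sum_left)
    then have "0 = (\<integral>x. (\<Sum>i<?n. d i x \<bullet> d k x) \<partial>?M)"
      by (simp add: integral_eq_zero_AE)
    also have "\<dots> = (\<Sum>i<?n. L2_inner \<Omega> (d i) (d k))"
      unfolding L2_inner_def by (rule Bochner_Integration.integral_sum) (use int in auto)
    also have "\<dots> = (\<Sum>i<?n. if i = k then L2_inner \<Omega> (d k) (d k) else 0)"
      by (intro sum.cong refl) (use orth' d k in auto)
    also have "\<dots> = (\<integral>x. d k x \<bullet> d k x \<partial>?M)" using k by (simp add: L2_inner_def)
    finally have "AE x in ?M. d k x \<bullet> d k x = 0"
      using integral_nonneg_eq_0_iff_AE[OF int[OF k]] by simp
    then show ?thesis unfolding L2_eq_def by eventually_elim (simp add: d_def)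
  qed
  show ?thesis
    unfolding L2_orthogonal_direct_sum_def
  proof (intro conjI ballI)
    show "\<forall>i<?n. \<forall>j<?n. i \<noteq> j \<longrightarrow> (\<forall>u\<in>Us ! i. \<forall>v\<in>Us ! j. L2_inner \<Omega> u v = 0)"
      using orth' by blast
    show "L2_subspace \<Omega> U" if "U \<in> set Us" for U by (rule sub[OF that])
    fix w :: "real^2 \<Rightarrow> real^2" assume "w \<in> L2 \<Omega>"
    from ex[OF this] obtain u where "\<forall>i<?n. u i \<in> Us ! i" "L2_eq \<Omega> w (\<lambda>x. \<Sum>i<?n. u i x)" by blast
    then show "\<exists>u. (\<forall>i<?n. u i \<in> Us ! i) \<and> L2_eq \<Omega> w (\<lambda>x. \<Sum>i<?n. u i x) \<and>
        (\<forall>u'. (\<forall>i<?n. u' i \<in> Us ! i) \<and> L2_eq \<Omega> w (\<lambda>x. \<Sum>i<?n. u' i x) \<longrightarrow>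
          (\<forall>i<?n. L2_eq \<Omega> (u' i) (u i)))"
      using unique[of u w] by (intro exI[of _ u]) blast
  qed
qed

theorem theorem4p1:
  fixes \<Omega> :: "(real^2) set"
  assumes "region \<Omega>"
    and "bounded \<Omega>"
    and "boundary_finite_union_Lipschitz_loops \<Omega>"
  shows "L2_orthogonal_direct_sum \<Omega> [Curl0 \<Omega>, N_curl \<Omega>] \<and>
         L2_orthogonal_direct_sum \<Omega> [G0 \<Omega>, N_div \<Omega>] \<and>
         L2_orthogonal_direct_sum \<Omega> [Curl0 \<Omega>, G0 \<Omega>, harmonic_fields \<Omega>]"
proof -
  have \<Omega>: "open \<Omega>" "bounded \<Omega>" using assms by (auto simp: region_def)
  have sG: "L2_subspace \<Omega> (G0 \<Omega>)" by (rule L2_subspace_G0[OF \<Omega>])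
  have sC: "L2_subspace \<Omega> (Curl0 \<Omega>)"
    unfolding Curl0_eq_perp_G0 by (rule L2_subspace_perp_image[OF sG])
  have sD: "L2_subspace \<Omega> (N_div \<Omega>)"
    unfolding N_div_eq using square_integrable_grad_C1c[OF \<Omega>(1)]
    by (intro L2_subspace_orthogonal_complement) (auto simp: L2_iff)
  have sR: "L2_subspace \<Omega> (N_curl \<Omega>)"
    unfolding N_curl_eq using square_integrable_perp[OF square_integrable_grad_C1c[OF \<Omega>(1)]]
    by (intro L2_subspace_orthogonal_complement) (auto simp: L2_iff perp_grad_def[abs_def])
  have sH: "L2_subspace \<Omega> (harmonic_fields \<Omega>)"
    unfolding harmonic_fields_eq by (rule L2_subspace_Int[OF sR sD])
  have orthG: "L2_inner \<Omega> g v = 0" if "g \<in> G0 \<Omega>" "v \<in> N_div \<Omega>" for g v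
    using G0_orthogonal_N_div[OF \<Omega>] that by blast
  have orthC: "L2_inner \<Omega> c v = 0" if c: "c \<in> Curl0 \<Omega>" and v: "v \<in> N_curl \<Omega>" for c v
  proof -
    obtain g where g: "g \<in> G0 \<Omega>" "c = (\<lambda>x. perp (g x))" using c by (auto simp: Curl0_eq_perp_G0)
    from L2_subspace_uminus[OF sR v] have "(\<lambda>x. perp (v x)) \<in> N_div \<Omega>"
      using perp_mem_N_curl_iff[of "\<lambda>x. perp (v x)" \<Omega>] by simp
    from orthG[OF g(1) this] show ?thesis by (simp add: L2_inner_def g(2) inner_perp_left)
  qed
  have "L2_orthogonal_direct_sum \<Omega> [Curl0 \<Omega>, N_curl \<Omega>]"
  proof (rule L2_orthogonal_direct_sumI)
    fix w :: "real^2 \<Rightarrow> real^2" assume w: "w \<in> L2 \<Omega>"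
    obtain c where c: "c \<in> Curl0 \<Omega>" "(\<lambda>x. w x - c x) \<in> N_curl \<Omega>"
      using exists_Curl0_N_curl_decomposition[OF \<Omega> w] by blast
    show "\<exists>u. (\<forall>i<length [Curl0 \<Omega>, N_curl \<Omega>]. u i \<in> [Curl0 \<Omega>, N_curl \<Omega>] ! i) \<and>
        L2_eq \<Omega> w (\<lambda>x. \<Sum>i<length [Curl0 \<Omega>, N_curl \<Omega>]. u i x)"
      using c by (intro exI[of _ "\<lambda>i. [c, \<lambda>x. w x - c x] ! i"])
        (auto simp: less_Suc_eq L2_eq_def numeral_eq_Suc)
  qed (use sC sR orthC in \<open>auto simp: less_Suc_eq numeral_eq_Suc\<close>)
  moreover have "L2_orthogonal_direct_sum \<Omega> [G0 \<Omega>, N_div \<Omega>]"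
  proof (rule L2_orthogonal_direct_sumI)
    fix w :: "real^2 \<Rightarrow> real^2" assume w: "w \<in> L2 \<Omega>"
    obtain g where g: "g \<in> G0 \<Omega>" "(\<lambda>x. w x - g x) \<in> N_div \<Omega>"
      using exists_G0_N_div_decomposition[OF \<Omega> w] by blast
    show "\<exists>u. (\<forall>i<length [G0 \<Omega>, N_div \<Omega>]. u i \<in> [G0 \<Omega>, N_div \<Omega>] ! i) \<and>
        L2_eq \<Omega> w (\<lambda>x. \<Sum>i<length [G0 \<Omega>, N_div \<Omega>]. u i x)"
      using g by (intro exI[of _ "\<lambda>i. [g, \<lambda>x. w x - g x] ! i"])
        (auto simp: less_Suc_eq L2_eq_def numeral_eq_Suc)
  qed (use sG sD orthG in \<open>auto simp: less_Suc_eq numeral_eq_Suc\<close>)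
  moreover have "L2_orthogonal_direct_sum \<Omega> [Curl0 \<Omega>, G0 \<Omega>, harmonic_fields \<Omega>]"
  proof (rule L2_orthogonal_direct_sumI)
    fix w :: "real^2 \<Rightarrow> real^2" assume w: "w \<in> L2 \<Omega>"
    obtain c where c: "c \<in> Curl0 \<Omega>" "(\<lambda>x. w x - c x) \<in> N_curl \<Omega>"
      using exists_Curl0_N_curl_decomposition[OF \<Omega> w] by blast
    have "(\<lambda>x. w x - c x) \<in> L2 \<Omega>" using c(2) by (simp add: N_curl_def)
    then obtain g where g: "g \<in> G0 \<Omega>" "(\<lambda>x. (w x - c x) - g x) \<in> N_div \<Omega>"
      using exists_G0_N_div_decomposition[OF \<Omega>] by blast
    have "(\<lambda>x. (w x - c x) - g x) \<in> N_curl \<Omega>"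
      using g(1) G0_subset_N_curl[OF \<Omega>] by (intro L2_subspace_diff[OF sR c(2)]) auto
    with g(2) have "(\<lambda>x. w x - c x - g x) \<in> harmonic_fields \<Omega>" by (simp add: harmonic_fields_eq)
    then show "\<exists>u. (\<forall>i<length [Curl0 \<Omega>, G0 \<Omega>, harmonic_fields \<Omega>].
          u i \<in> [Curl0 \<Omega>, G0 \<Omega>, harmonic_fields \<Omega>] ! i) \<and>
        L2_eq \<Omega> w (\<lambda>x. \<Sum>i<length [Curl0 \<Omega>, G0 \<Omega>, harmonic_fields \<Omega>]. u i x)"
      using c(1) g(1) by (intro exI[of _ "\<lambda>i. [c, g, \<lambda>x. w x - c x - g x] ! i"])
        (auto simp: less_Suc_eq L2_eq_def numeral_eq_Suc)
  next
    fix i j u v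
    assume "i < j" "j < length [Curl0 \<Omega>, G0 \<Omega>, harmonic_fields \<Omega>]"
      "u \<in> [Curl0 \<Omega>, G0 \<Omega>, harmonic_fields \<Omega>] ! i" "v \<in> [Curl0 \<Omega>, G0 \<Omega>, harmonic_fields \<Omega>] ! j"
    then show "L2_inner \<Omega> u v = 0"
      using orthC orthG G0_subset_N_curl[OF \<Omega>]
      by (auto simp: less_Suc_eq numeral_eq_Suc harmonic_fields_eq)
  qed (use sC sG sH in auto)
  ultimately show ?thesis by blast
qed

end
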